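(* Let $\widetilde x$ be a simple $T$-periodic cycle of $\dot x=f(x)$. Let $0\le\theta_1<\theta_2\le\theta_1+\frac{T}{p}$, where $p\in\mathbb{N}$ and $\frac Tp$ is the least period of $\widetilde x$. Assume that $$M_{\widetilde x}(\theta_1)\cdot M_{\widetilde x}(\theta_2)<0 .$$ Denote by $\Theta$ the set of all zeros of $M_{\widetilde x}$ in $(\theta_1,\theta_2)$. Then for all sufficiently small $\varepsilon>0$ the system $\dot x=f(x)+\varepsilon g(t,x,\varepsilon)$ has a $T$-periodic solution $x_\varepsilon$ such that $$\rho\bigl(x_\varepsilon(t),\widetilde x(t+\Theta)\bigr)\to0\quad\text{as }\varepsilon\to0 .$$
   Context: $T>0$; $f:\mathbb{R}^n\to\mathbb{R}^n$ is continuously differentiable; $g:\mathbb{R}\times\mathbb{R}^n\times[0,1]\to\mathbb{R}^n$ is continuous and $T$-periodic in the first variable. A cycle is a nonconstant periodic solution. A $T$-periodic cycle $\widetilde x$ of $\dot x=f(x)$ is called simple if the multiplier $+1$ of the $T$-periodic linear system $\dot y=f'(\widetilde x(t))y$ (eigenvalue of the monodromy matrix over $[0,T]$) has algebraic multiplicity $1$. For a simple cycle $\widetilde x$, $$M_{\widetilde x}(\theta)=\operatorname{sign}\langle\dot{\widetilde x}(0),\widetilde z(0)\rangle\int_0^T\langle\widetilde z(\tau),g(\tau-\theta,\widetilde x(\tau),0)\rangle\,d\tau,$$ where $\widetilde z$ is an arbitrary fixed nontrivial $T$-periodic solution of $\dot z=-(f'(\widetilde x(t)))^*z$. $\rho(\xi,K)=\min_{\zeta\in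 K}\|\xi-\zeta\|$ is the distance from a point to a compact set, and $\widetilde x(t+\Theta)=\{\widetilde x(t+\theta):\theta\in\Theta\}$. *)

theory Defs
  imports "HOL-Analysis.Analysis" "HOL-Computational_Algebra.Polynomial"
begin

definition periodic :: "real \<Rightarrow> (real \<Rightarrow> 'a) \<Rightarrow> bool" where
  "periodic T x \<longleftrightarrow> (\<forall>t. x (t + T) = x t)"

definition least_period :: "real \<Rightarrow> (real \<Rightarrow> 'a) \<Rightarrow> bool" where
  "least_period P x \<longleftrightarrow> 0 < P \<and> periodic P x \<and> (\<forall>s. 0 < s \<and> s < P \<longrightarrow> \<not> periodic s x)"

definition solves_ode :: "(real \<Rightarrow> 'a \<Rightarrow> 'a) \<Rightarrow> (real \<Rightarrow> 'a::real_normed_vector) \<Rightarrow> bool" where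
  "solves_ode F x \<longleftrightarrow> (\<forall>t. (x has_vector_derivative F t (x t)) (at t))"

definition C1 :: "(real^'n \<Rightarrow> real^'n) \<Rightarrow> bool" where
  "C1 f \<longleftrightarrow> (\<forall>x. f differentiable at x) \<and> continuous_on UNIV (\<lambda>x. jacobian f (at x))"

definition periodic_cycle :: "real \<Rightarrow> (real^'n \<Rightarrow> real^'n) \<Rightarrow> (real \<Rightarrow> real^'n) \<Rightarrow> bool" where
  "periodic_cycle T f x \<longleftrightarrow>
     solves_ode (\<lambda>t. f) x \<and> periodic T x \<and> (\<exists>s t. x s \<noteq> x t)"

definition char_polynomial :: "real^'n^'n \<Rightarrow> real poly" where
  "char_polynomial A = det (\<chi> i j. (if i = j then [:0, 1:] else 0) - [:A $ i $ j:])"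

text \<open>The monodromy matrix over \<open>[0, T]\<close> of \<open>y' = A t y\<close> is the value at \<open>T\<close> of the
  matrix solution that starts at the identity; it is unique when \<open>A\<close> is continuous.\<close>

definition is_monodromy_matrix :: "real \<Rightarrow> (real \<Rightarrow> real^'n^'n) \<Rightarrow> real^'n^'n \<Rightarrow> bool" where
  "is_monodromy_matrix T A W \<longleftrightarrow>
     (\<exists>Y. solves_ode (\<lambda>t Z. A t ** Z) Y \<and> Y 0 = mat 1 \<and> W = Y T)"

text \<open>The algebraic multiplicity of an eigenvalue is its order as a root of the
  characteristic polynomial.\<close>

definition simple_cycle :: "real \<Rightarrow> (real^'n \<Rightarrow> real^'n) \<Rightarrow> (real \<Rightarrow> real^'n) \<Rightarrow> bool" where
  "simple_cycle T f x \<longleftrightarrow> periodic_cycle T f x \<and>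
     (\<exists>W. is_monodromy_matrix T (\<lambda>t. jacobian f (at (x t))) W \<and>
          order 1 (char_polynomial W) = 1)"

definition adjoint_solution ::
    "real \<Rightarrow> (real^'n \<Rightarrow> real^'n) \<Rightarrow> (real \<Rightarrow> real^'n) \<Rightarrow> (real \<Rightarrow> real^'n) \<Rightarrow> bool" where
  "adjoint_solution T f x z \<longleftrightarrow>
     solves_ode (\<lambda>t v. - (transpose (jacobian f (at (x t))) *v v)) z \<and>
     periodic T z \<and> (\<exists>t. z t \<noteq> 0)"

definition bifurcation_fun ::
    "real \<Rightarrow> (real \<Rightarrow> real^'n \<Rightarrow> real \<Rightarrow> real^'n) \<Rightarrow> (real \<Rightarrow> real^'n) \<Rightarrow> (real \<Rightarrow> real^'n) \<Rightarrow> real \<Rightarrow> real"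
  where
  "bifurcation_fun T g x z \<theta> =
     sgn (inner (vector_derivative x (at 0)) (z 0)) *
     integral {0..T} (\<lambda>\<tau>. inner (z \<tau>) (g (\<tau> - \<theta>) (x \<tau>) 0))"

end

theory Submission
  imports Defs "HOL-Complex_Analysis.Great_Picard"
begin

text \<open>
A \<open>T\<close>-periodic solution near \<open>x (t + \<theta>)\<close> is sought in the form \<open>X (t + \<theta>)\<close>, where
\<open>X' = f X + \<epsilon> g (t - \<theta>) X \<epsilon>\<close> and \<open>X 0 = x 0 + \<epsilon> v\<close>. The unknowns are the phase \<open>\<theta>\<close> in
\<open>[\<theta>1, \<theta>2]\<close> and the vector \<open>v\<close>. Let \<open>W\<close> be the monodromy matrix, \<open>e = f (x 0)\<close>, and
\<open>V = (X T - x T) / \<epsilon>\<close>, so that \<open>X\<close> is periodic if \<open>V = v\<close>. Gronwall estimates give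
\<open>V = W v + c\<close> with \<open>c\<close> bounded independently of \<open>v\<close>, for \<open>v\<close> in any fixed ball and small \<open>\<epsilon>\<close>;
and since \<open>z\<close> solves the adjoint equation, \<open>z 0 \<bullet> (V - v)\<close> is close to the integral in the
bifurcation function at \<open>\<theta>\<close> (lemma \<open>first_order_expansion\<close>).

The hypothesis on the signs forces \<open>z 0 \<bullet> e \<noteq> 0\<close>. As the multiplier 1 is simple, the bordered map
\<open>v \<mapsto> W v - v + (z 0 \<bullet> v) e\<close> is then invertible (lemma \<open>bordered_inverse\<close>). Solving the
bordered equation with right-hand side \<open>- c\<close> for \<open>v\<close>, and moving \<open>\<theta>\<close> in proportion to \<open>z 0 \<bullet> v\<close>, gives
a self-map of \<open>[\<theta>1, \<theta>2]\<close> times a ball. At a fixed point \<open>V - v = - (z 0 \<bullet> v) e\<close>, and the opposite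
signs of the bifurcation function at \<open>\<theta>1\<close> and \<open>\<theta>2\<close> leave only \<open>z 0 \<bullet> v = 0\<close>, as in the
theorem of Poincare and Miranda (lemma \<open>periodic_solutions_exist\<close>).

Since \<open>g\<close> is only continuous, \<open>V\<close> is not a function of \<open>(\<theta>, v)\<close>. Lemma
\<open>boundary_value_problem_solvable\<close> replaces the missing Poincare map: it applies Brouwer's theorem to
Euler polygons and passes to the limit. All estimates concern exact solutions only.

Conversely, for small \<open>\<epsilon>\<close> every periodic solution with bounded \<open>v\<close> makes the bifurcation function at its phase
\<open>\<theta>\<close> small. By compactness \<open>\<theta>\<close> is then close to a zero of that function in the open interval,
which gives the convergence.
\<close>

section \<open>Boundary value problems without uniqueness\<close>

primrec euler_node :: "(real \<Rightarrow> 'a \<Rightarrow> 'a) \<Rightarrow> real \<Rightarrow> 'a \<Rightarrow> nat \<Rightarrow> 'a::real_vector" where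
  "euler_node G h a 0 = a"
| "euler_node G h a (Suc j) = euler_node G h a j + h *\<^sub>R G (real j * h) (euler_node G h a j)"

text \<open>Writing the polygon as a sum of ramps makes each of its increments a combination of the slopes
with nonnegative weights that add up to the length of the time interval. Estimates for the polygon
then need no integrals and no case distinction by subintervals.\<close>

definition ramp :: "real \<Rightarrow> real \<Rightarrow> real" where
  "ramp h u = max 0 (min u h)"

definition euler_polygon ::
    "(real \<Rightarrow> 'a \<Rightarrow> 'a) \<Rightarrow> real \<Rightarrow> 'a \<Rightarrow> nat \<Rightarrow> real \<Rightarrow> 'a::real_vector" where
  "euler_polygon G h a N t =
     a + (\<Sum>j<N. ramp h (t - real j * h) *\<^sub>R G (real j * h) (euler_node G h a j))"

lemma sum_ramp:
  assumes "0 \<le> h"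
  shows "(\<Sum>j<N. ramp h (t - real j * h)) = max 0 (min t (real N * h))"
proof (induction N)
  case (Suc N)
  have "0 \<le> real N * h" using assms by simp
  moreover have "max 0 (min t c) + max 0 (min (t - c) h) = max 0 (min t (c + h))" if "0 \<le> c" for c
    using that assms by linarith
  ultimately show ?case
    by (simp add: Suc.IH ramp_def[of h "t - real N * h"]) (simp add: algebra_simps)
qed simp

lemma euler_polygon_node:
  assumes "0 \<le> h" "k \<le> N"
  shows "euler_polygon G h a N (real k * h) = euler_node G h a k"
proof -
  have node: "euler_node G h a k = a + (\<Sum>j<k. h *\<^sub>R G (real j * h) (euler_node G h a j))"
    by (induction k) (simp_all add: algebra_simps)
  have r: "ramp h (real k * h - real j * h) = (if j < k then h else 0)" for j
  proof (cases "j < k")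
    case True
    have "h * 1 \<le> h * (real k - real j)" using True assms by (intro mult_left_mono) auto
    then show ?thesis using True assms by (simp add: ramp_def algebra_simps)
  next
    case False
    have "h * (real k - real j) \<le> 0" using False assms by (intro mult_nonneg_nonpos) auto
    then show ?thesis using False assms by (simp add: ramp_def algebra_simps)
  qed
  have "(\<Sum>j<N. ramp h (real k * h - real j * h) *\<^sub>R G (real j * h) (euler_node G h a j))
      = (\<Sum>j<k. h *\<^sub>R G (real j * h) (euler_node G h a j))"
    unfolding r using assms(2) by (intro sum.mono_neutral_cong_right) auto
  then show ?thesis unfolding euler_polygon_def node by simp
qed

text \<open>Only the slopes at nodes whose step meets \<open>[a, b]\<close> enter the increment, so the polygon follows
every vector \<open>c\<close> that is close to those slopes. With \<open>c = 0\<close> this gives a Lipschitz bound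
independent of the step, and with \<open>c\<close> the value of the field at a limit point it gives the
differential equation in the limit.\<close>

lemma euler_polygon_increment:
  fixes G :: "real \<Rightarrow> 'a \<Rightarrow> 'a::real_normed_vector"
  assumes h: "0 \<le> h" and ab: "0 \<le> a" "a \<le> b" "b \<le> real N * h"
    and near: "\<And>j. j < N \<Longrightarrow> real j * h \<le> b \<Longrightarrow> a \<le> real (Suc j) * h
        \<Longrightarrow> norm (G (real j * h) (euler_node G h y j) - c) \<le> e"
  shows "norm (euler_polygon G h y N b - euler_polygon G h y N a - (b - a) *\<^sub>R c) \<le> e * (b - a)"
proof -
  define w where "w j = ramp h (b - real j * h) - ramp h (a - real j * h)" for j
  define V where "V j = G (real j * h) (euler_node G h y j)" for j
  have wsum: "(\<Sum>j<N. w j) = b - a"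
    unfolding w_def sum_subtractf sum_ramp[OF h] using ab by simp
  have "euler_polygon G h y N b - euler_polygon G h y N a = (\<Sum>j<N. w j *\<^sub>R V j)"
    by (simp add: euler_polygon_def w_def V_def sum_subtractf scaleR_diff_left)
  then have "euler_polygon G h y N b - euler_polygon G h y N a - (b - a) *\<^sub>R c
      = (\<Sum>j<N. w j *\<^sub>R (V j - c))"
    by (simp add: wsum[symmetric] sum_subtractf scaleR_diff_right scaleR_sum_left)
  moreover have "norm (w j *\<^sub>R (V j - c)) \<le> e * w j" if "j < N" for j
  proof (cases "w j = 0")
    case False
    have "w j \<ge> 0" using ab by (simp add: w_def ramp_def)
    moreover have "real j * h \<le> b" "a \<le> real (Suc j) * h"
      using False h ab by (auto simp: w_def ramp_def algebra_simps max_def min_def split: if_splits)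
    then have "norm (V j - c) \<le> e" using near[OF that] by (simp add: V_def)
    ultimately show ?thesis by (simp add: mult.commute[of e] mult_left_mono)
  qed simp
  then have "norm (\<Sum>j<N. w j *\<^sub>R (V j - c)) \<le> (\<Sum>j<N. e * w j)"
    by (intro sum_norm_le) auto
  ultimately show ?thesis by (simp add: sum_distrib_left[symmetric] wsum)
qed

lemma continuous_on_euler_node:
  fixes F :: "real \<Rightarrow> 'a \<Rightarrow> 'p::topological_space \<Rightarrow> 'a::real_normed_vector"
  assumes F: "continuous_on ({0..T} \<times> UNIV \<times> S) (\<lambda>(t, v, s). F t v s)"
    and \<xi>: "continuous_on S \<xi>" and h: "0 \<le> h"
  shows "real j * h \<le> T \<Longrightarrow> continuous_on S (\<lambda>s. euler_node (\<lambda>t v. F t v s) h (\<xi> s) j)"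
proof (induction j)
  case (Suc j)
  have j: "real j * h \<le> T" using Suc.prems h by (simp add: algebra_simps)
  have "continuous_on S ((\<lambda>(t, v, s). F t v s) \<circ>
      (\<lambda>s. (real j * h, euler_node (\<lambda>t v. F t v s) h (\<xi> s) j, s)))"
    using j h Suc.IH[OF j]
    by (intro continuous_on_compose continuous_intros continuous_on_subset[OF F]) auto
  then show ?case using Suc.IH[OF j] by (auto intro!: continuous_intros simp: o_def)
qed (simp add: \<xi>)

text \<open>A boundary value problem for a field that is merely continuous, so that initial values need not
determine solutions and no Poincare map exists. The endpoint of an Euler polygon does depend
continuously on \<open>s\<close>, being a finite composition of continuous maps; Brouwer's theorem therefore
solves \<open>\<Psi> s (X T) = s\<close> for each step size, and the solutions accumulate at a solution of the
original problem by the theorem of Arzela and Ascoli.\<close>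

theorem boundary_value_problem_solvable:
  fixes F :: "real \<Rightarrow> 'a::euclidean_space \<Rightarrow> 'p::euclidean_space \<Rightarrow> 'a"
  assumes T: "T > 0" and S: "compact S" "convex S" "S \<noteq> {}"
    and F: "continuous_on ({0..T} \<times> UNIV \<times> S) (\<lambda>(t, v, s). F t v s)"
    and B: "\<And>t v s. t \<in> {0..T} \<Longrightarrow> s \<in> S \<Longrightarrow> norm (F t v s) \<le> B"
    and \<xi>: "continuous_on S \<xi>"
    and \<Psi>: "continuous_on (S \<times> UNIV) (\<lambda>(s, y). \<Psi> s y)" "\<And>s y. s \<in> S \<Longrightarrow> \<Psi> s y \<in> S"
  obtains s X where "s \<in> S" "X 0 = \<xi> s" "\<Psi> s (X T) = s"
    "\<And>t. t \<in> {0..T} \<Longrightarrow> (X has_vector_derivative F t (X t) s) (at t within {0..T})"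
proof -
  define h where "h n = T / real (Suc n)" for n
  have h: "h n > 0" "real (Suc n) * h n = T" for n using T by (auto simp: h_def)
  have h0: "h \<longlonglongrightarrow> 0"
    unfolding h_def by (rule tendsto_divide_0[OF tendsto_const])
      (metis LIMSEQ_Suc filterlim_at_top_imp_at_infinity filterlim_real_sequentially
        filterlim_sequentially_Suc)
  define E where "E n s j = euler_node (\<lambda>t v. F t v s) (h n) (\<xi> s) j" for n s j
  have "\<exists>s\<in>S. \<Psi> s (E n s (Suc n)) = s" for n
  proof -
    have E: "continuous_on S (\<lambda>s. E n s (Suc n))"
      unfolding E_def using h[of n] by (intro continuous_on_euler_node[OF F \<xi>]) auto
    have "continuous_on S ((\<lambda>(s, y). \<Psi> s y) \<circ> (\<lambda>s. (s, E n s (Suc n))))"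
      by (intro continuous_on_compose continuous_intros E continuous_on_subset[OF \<Psi>(1)]) auto
    then have "continuous_on S (\<lambda>s. \<Psi> s (E n s (Suc n)))" by (simp add: o_def)
    moreover have "(\<lambda>s. \<Psi> s (E n s (Suc n))) \<in> S \<rightarrow> S" using \<Psi>(2) by blast
    ultimately obtain q where "q \<in> S" "\<Psi> q (E n q (Suc n)) = q" by (rule brouwer[OF S])
    then show ?thesis by blast
  qed
  then have "\<forall>n. \<exists>q. q \<in> S \<and> \<Psi> q (E n q (Suc n)) = q" by blast
  from choice[OF this]
  obtain s where s: "\<And>n. s n \<in> S" "\<And>n. \<Psi> (s n) (E n (s n) (Suc n)) = s n" by blast
  define P where "P n = euler_polygon (\<lambda>t v. F t v (s n)) (h n) (\<xi> (s n)) (Suc n)" for n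
  have node: "P n (real j * h n) = E n (s n) j" if "j \<le> Suc n" for n j
    unfolding P_def E_def using that h[of n] by (intro euler_polygon_node) auto
  have P0: "P n 0 = \<xi> (s n)" for n using node[of 0 n] by (simp add: E_def)
  have PT: "P n T = E n (s n) (Suc n)" for n using node[of "Suc n" n] h(2)[of n] by simp
  have inc: "norm (P n b - P n a - (b - a) *\<^sub>R c) \<le> e * (b - a)"
    if ab: "0 \<le> a" "a \<le> b" "b \<le> T"
      and near: "\<And>j. j \<le> n \<Longrightarrow> real j * h n \<le> b \<Longrightarrow> a \<le> real (Suc j) * h n
        \<Longrightarrow> norm (F (real j * h n) (E n (s n) j) (s n) - c) \<le> e" for n a b c e
    unfolding P_def using ab near h[of n]
    by (intro euler_polygon_increment) (auto simp: E_def)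
  have inT: "real j * h n \<in> {0..T}" if "j \<le> Suc n" for j n
  proof -
    have "real j * h n \<le> real (Suc n) * h n"
      using that h(1)[of n] by (intro mult_right_mono) auto
    then show ?thesis using h[of n] by auto
  qed
  have B0: "0 \<le> B" using B[of 0 "s 0" 0] s(1) T by (meson atLeastAtMost_iff less_imp_le norm_ge_zero order_trans order_refl)
  have lip: "norm (P n b - P n a) \<le> B * \<bar>b - a\<bar>" if "a \<in> {0..T}" "b \<in> {0..T}" for a b n
  proof -
    have *: "norm (P n b - P n a) \<le> B * (b - a)" if "0 \<le> a" "a \<le> b" "b \<le> T" for a b
      using inc[OF that, of n 0 B] B inT s(1) by auto
    show ?thesis
    proof (cases "a \<le> b")
      case True then show ?thesis using *[of a b] that by auto
    next
      case False then show ?thesis using *[of b a] that by (auto simp: norm_minus_commute)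
    qed
  qed
  obtain M1 where M1: "\<And>r. r \<in> S \<Longrightarrow> norm (\<xi> r) \<le> M1"
    using compact_imp_bounded[OF compact_continuous_image[OF \<xi> S(1)]] by (auto simp: bounded_iff)
  obtain M2 where M2: "\<And>r. r \<in> S \<Longrightarrow> norm r \<le> M2"
    using compact_imp_bounded[OF S(1)] by (auto simp: bounded_iff)
  have bnd: "norm (P n t, s n) \<le> (M1 + B * T) + M2" if "t \<in> {0..T}" for n t
  proof -
    have "norm (P n t) \<le> norm (P n 0) + norm (P n t - P n 0)"
      by (metis add.commute diff_add_cancel norm_triangle_ineq)
    also have "\<dots> \<le> M1 + B * T"
      using lip[of 0 t n] that M1[OF s(1)[of n]] mult_left_mono[OF _ B0, of t T] T
      by (auto simp: P0 intro!: add_mono intro: order_trans)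
    finally show ?thesis using M2[OF s(1)[of n]] norm_Pair_le[of "P n t" "s n"] by linarith
  qed
  have equi: "\<exists>d>0. \<forall>n y. y \<in> {0..T} \<and> norm (t - y) < d \<longrightarrow> norm ((P n t, s n) - (P n y, s n)) < e"
    if t: "t \<in> {0..T}" and e: "0 < e" for t e :: real
  proof (intro exI[of _ "e / (B + 1)"] conjI allI impI)
    fix n y assume y: "y \<in> {0..T} \<and> norm (t - y) < e / (B + 1)"
    have "norm (P n t - P n y) \<le> B * \<bar>t - y\<bar>" using lip y t by auto
    also have "\<dots> \<le> (B + 1) * \<bar>t - y\<bar>" by (intro mult_right_mono) auto
    also have "\<dots> < e" using y B0 by (simp add: field_simps)
    finally show "norm ((P n t, s n) - (P n y, s n)) < e" by (simp add: norm_Pair)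
  qed (use e B0 in auto)
  \<comment> \<open>Applied to the pairs, so that polygons and parameters converge along the same subsequence.\<close>
  obtain XS k where k: "strict_mono (k :: nat \<Rightarrow> nat)"
    and conv: "\<And>e. 0 < e \<Longrightarrow> \<exists>N. \<forall>n t. n \<ge> N \<and> t \<in> {0..T} \<longrightarrow> norm ((P (k n) t, s (k n)) - XS t) < e"
    by (rule Arzela_Ascoli[of "{0..T}" "\<lambda>n t. (P n t, s n)", OF compact_Icc bnd equi])
      (assumption+, rule that, assumption+)
  define X where "X t = fst (XS t)" for t
  define r where "r = snd (XS 0)"
  have lim: "(\<lambda>n. (P (k n) t, s (k n))) \<longlonglongrightarrow> XS t" if "t \<in> {0..T}" for t
    unfolding LIMSEQ_iff using conv that by blast
  have limP: "(\<lambda>n. P (k n) t) \<longlonglongrightarrow> X t" if "t \<in> {0..T}" for t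
    using tendsto_fst[OF lim[OF that]] by (simp add: X_def)
  have lims: "(\<lambda>n. s (k n)) \<longlonglongrightarrow> r"
    using tendsto_snd[OF lim[of 0]] T by (simp add: r_def)
  have limh: "(\<lambda>n. h (k n)) \<longlonglongrightarrow> 0"
    using LIMSEQ_subseq_LIMSEQ[OF h0 k] by (simp add: o_def)
  have rS: "r \<in> S"
    using closed_sequentially[OF compact_imp_closed[OF S(1)] _ lims] s(1) by blast
  have "(\<lambda>n. \<xi> (s (k n))) \<longlonglongrightarrow> \<xi> r"
    using \<xi> lims s(1) rS by (auto simp: continuous_on_sequentially o_def)
  with limP[of 0] have X0: "X 0 = \<xi> r" using T by (auto simp: P0 intro: LIMSEQ_unique)
  have "(\<lambda>n. (s (k n), P (k n) T)) \<longlonglongrightarrow> (r, X T)"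
    using lims limP[of T] T by (intro tendsto_Pair) auto
  then have "(\<lambda>n. \<Psi> (s (k n)) (P (k n) T)) \<longlonglongrightarrow> \<Psi> r (X T)"
    using \<Psi>(1)[unfolded continuous_on_sequentially, rule_format, of "(r, X T)" "\<lambda>n. (s (k n), P (k n) T)"]
      s(1) rS by (auto simp: o_def)
  then have \<Psi>r: "\<Psi> r (X T) = r"
    using lims by (auto simp: PT s(2) intro: LIMSEQ_unique)
  have "(X has_vector_derivative F t (X t) r) (at t within {0..T})" if t: "t \<in> {0..T}" for t
    unfolding has_vector_derivative_def has_derivative_within_alt
  proof (intro conjI allI impI bounded_linear_scaleR_left)
    fix e :: real assume e: "0 < e"
    obtain d where d: "d > 0" and dF: "\<And>t' v s'. t' \<in> {0..T} \<Longrightarrow> s' \<in> S \<Longrightarrow>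
        \<bar>t' - t\<bar> + (dist v (X t) + dist s' r) < d \<Longrightarrow> norm (F t' v s' - F t (X t) r) \<le> e"
    proof -
      obtain d where "d > 0" and d: "\<And>q. q \<in> {0..T} \<times> UNIV \<times> S \<Longrightarrow> dist q (t, X t, r) < d \<Longrightarrow>
          dist ((\<lambda>(t, v, s). F t v s) q) (F t (X t) r) < e"
        using F[unfolded continuous_on_iff, rule_format, of "(t, X t, r)" e] t rS e by auto
      show thesis
      proof (rule that[OF \<open>d > 0\<close>])
        fix t' v s' assume "t' \<in> {0..T}" "s' \<in> S" and *: "\<bar>t' - t\<bar> + (dist v (X t) + dist s' r) < d"
        have "dist (t', v, s') (t, X t, r) \<le> dist t' t + (dist v (X t) + dist s' r)"
          by (smt (verit) dist_Pair_Pair sqrt_sum_squares_le_sum zero_le_dist)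
        with * d[of "(t', v, s')"] \<open>t' \<in> {0..T}\<close> \<open>s' \<in> S\<close>
        show "norm (F t' v s' - F t (X t) r) \<le> e" by (simp add: dist_norm)
      qed
    qed
    \<comment> \<open>Half of \<open>d\<close> is left for the step size and for the distance to the limit.\<close>
    define \<delta> where "\<delta> = d / (2 * (B + 1))"
    have \<delta>: "\<delta> > 0" "(B + 1) * \<delta> = d / 2" using d B0 by (auto simp: \<delta>_def field_simps)
    have key: "norm (X b - X a - (b - a) *\<^sub>R F t (X t) r) \<le> e * (b - a)"
      if ab: "0 \<le> a" "a \<le> b" "b \<le> T" "a \<le> t" "t \<le> b" "t - a < \<delta>" "b - t < \<delta>" for a b
    proof -
      define \<epsilon> where "\<epsilon> = (\<lambda>n. (B + 1) * (max (t - a) (b - t) + h (k n)) + dist (P (k n) t) (X t) + dist (s (k n)) r)"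
      have "\<epsilon> \<longlonglongrightarrow> (B + 1) * (max (t - a) (b - t) + 0) + dist (X t) (X t) + dist r r"
        unfolding \<epsilon>_def by (intro tendsto_intros limh limP[OF t] lims)
      moreover have "(B + 1) * max (t - a) (b - t) < (B + 1) * \<delta>"
        using ab B0 by (intro mult_strict_left_mono) auto
      ultimately have "\<forall>\<^sub>F n in sequentially. \<epsilon> n < d"
        using \<delta>(2) d by (elim order_tendstoD(2)) auto
      then have "\<forall>\<^sub>F n in sequentially. norm (P (k n) b - P (k n) a - (b - a) *\<^sub>R F t (X t) r) \<le> e * (b - a)"
      proof eventually_elim
        case (elim n)
        show ?case
        proof (rule inc[OF ab(1-3)])
          fix j assume j: "j \<le> k n" "real j * h (k n) \<le> b" "a \<le> real (Suc j) * h (k n)"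
          have jT: "real j * h (k n) \<in> {0..T}" using inT j by auto
          have dt: "\<bar>real j * h (k n) - t\<bar> \<le> max (t - a) (b - t) + h (k n)"
            using j h(1)[of "k n"] ab by (auto simp: algebra_simps)
          have "dist (E (k n) (s (k n)) j) (X t) \<le> norm (P (k n) (real j * h (k n)) - P (k n) t) + dist (P (k n) t) (X t)"
            using node[of j "k n"] j by (metis dist_norm dist_triangle le_Suc_eq)
          also have "\<dots> \<le> B * \<bar>real j * h (k n) - t\<bar> + dist (P (k n) t) (X t)"
            using lip[OF t jT] by simp
          also have "\<dots> \<le> B * (max (t - a) (b - t) + h (k n)) + dist (P (k n) t) (X t)"
            using dt B0 by (intro add_right_mono mult_left_mono) auto
          finally have "\<bar>real j * h (k n) - t\<bar> + (dist (E (k n) (s (k n)) j) (X t) + dist (s (k n)) r) \<le> \<epsilon> n"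
            using dt by (simp add: \<epsilon>_def algebra_simps)
          then show "norm (F (real j * h (k n)) (E (k n) (s (k n)) j) (s (k n)) - F t (X t) r) \<le> e"
            using dF[OF jT s(1)] elim by auto
        qed
      qed
      moreover have "(\<lambda>n. norm (P (k n) b - P (k n) a - (b - a) *\<^sub>R F t (X t) r))
          \<longlonglongrightarrow> norm (X b - X a - (b - a) *\<^sub>R F t (X t) r)"
        using ab by (intro tendsto_intros limP) auto
      ultimately show ?thesis
        by (intro tendsto_upperbound[OF _ _ sequentially_bot]) auto
    qed
    show "\<exists>d>0. \<forall>y\<in>{0..T}. norm (y - t) < d \<longrightarrow>
        norm (X y - X t - (y - t) *\<^sub>R F t (X t) r) \<le> e * norm (y - t)"
    proof (intro exI[of _ \<delta>] conjI ballI impI \<delta>(1))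
      fix y assume y: "y \<in> {0..T}" "norm (y - t) < \<delta>"
      show "norm (X y - X t - (y - t) *\<^sub>R F t (X t) r) \<le> e * norm (y - t)"
      proof (cases "t \<le> y")
        case True
        then show ?thesis using key[of t y] y t \<delta>(1) by auto
      next
        case False
        have "X y - X t - (y - t) *\<^sub>R F t (X t) r = - (X t - X y - (t - y) *\<^sub>R F t (X t) r)"
          by (simp add: algebra_simps)
        then have "norm (X y - X t - (y - t) *\<^sub>R F t (X t) r) = norm (X t - X y - (t - y) *\<^sub>R F t (X t) r)"
          by (metis norm_minus_cancel)
        then show ?thesis using key[of y t] y t \<delta>(1) False by simp
      qed
    qed
  qed
  from that[OF rS X0 \<Psi>r this] show thesis .
qed

section \<open>A Gronwall estimate, matrix products and periodic functions\<close>

text \<open>The square of the norm is differentiable also where \<open>D\<close> vanishes, and it satisfies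
\<open>q' \<le> (2 L + 1) q + G\<^sup>2\<close> by \<open>2 \<bar>D\<bar> G \<le> \<bar>D\<bar>\<^sup>2 + G\<^sup>2\<close>. The resulting constant is not sharp, but it
depends on \<open>L\<close> and \<open>T\<close> only and the bound is homogeneous in \<open>(D 0, G)\<close>, which is what
rescaling by \<open>\<epsilon>\<close> needs.\<close>

lemma gronwall_affine:
  fixes D :: "real \<Rightarrow> 'a::real_inner"
  assumes D: "\<And>t. t \<in> {0..T} \<Longrightarrow> (D has_vector_derivative D' t) (at t within {0..T})"
    and bound: "\<And>t. t \<in> {0..T} \<Longrightarrow> norm (D' t) \<le> L * norm (D t) + G"
    and L: "0 \<le> L" and G: "0 \<le> G" and t: "t \<in> {0..T}"
  shows "norm (D t) \<le> sqrt ((1 + T) * exp ((2 * L + 1) * T)) * (norm (D 0) + G)"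
proof -
  define c where "c = 2 * L + 1"
  define q where "q s = D s \<bullet> D s" for s
  define \<phi> where "\<phi> s = exp (- c * s) * q s - G\<^sup>2 * s" for s
  have T: "0 \<le> T" and c: "0 \<le> c" using t L by (auto simp: c_def)
  have dq: "(q has_real_derivative 2 * (D s \<bullet> D' s)) (at s within {0..T})" if "s \<in> {0..T}" for s
  proof -
    have "((\<lambda>s. D s \<bullet> D s) has_vector_derivative D s \<bullet> D' s + D' s \<bullet> D s) (at s within {0..T})"
      by (rule bounded_bilinear.has_vector_derivative[OF bounded_bilinear_inner D[OF that] D[OF that]])
    then show ?thesis
      by (simp add: q_def[abs_def] has_real_derivative_iff_has_vector_derivative inner_commute)
  qed
  have d\<phi>: "(\<phi> has_real_derivative exp (- c * s) * (2 * (D s \<bullet> D' s) - c * q s) - G\<^sup>2) (at s within {0..T})"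
    if "s \<in> {0..T}" for s
    unfolding \<phi>_def[abs_def] using dq[OF that]
    by (auto intro!: derivative_eq_intros simp: algebra_simps)
  have "\<phi> t \<le> \<phi> 0"
  proof (cases "t = 0")
    case False
    show ?thesis
    proof (rule DERIV_nonpos_imp_decreasing_open[of 0 t])
      fix s assume s: "0 < s" "s < t"
      then have sT: "s \<in> {0..T}" using t by auto
      have "D s \<bullet> D' s \<le> norm (D s) * norm (D' s)" by (rule norm_cauchy_schwarz)
      also have "\<dots> \<le> norm (D s) * (L * norm (D s) + G)"
        using bound[OF sT] by (intro mult_left_mono) auto
      finally have "2 * (D s \<bullet> D' s) \<le> 2 * L * (norm (D s))\<^sup>2 + 2 * (norm (D s) * G)"
        by (simp add: power2_eq_square algebra_simps)
      also have "2 * (norm (D s) * G) \<le> (norm (D s))\<^sup>2 + G\<^sup>2"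
        using sum_squares_bound[of "norm (D s)" G] by (simp add: algebra_simps)
      finally have "2 * (D s \<bullet> D' s) - c * q s \<le> G\<^sup>2"
        by (simp add: c_def q_def power2_norm_eq_inner algebra_simps)
      then have "exp (- c * s) * (2 * (D s \<bullet> D' s) - c * q s) \<le> exp (- c * s) * G\<^sup>2"
        by (intro mult_left_mono) auto
      also have "\<dots> \<le> 1 * G\<^sup>2"
        using c s by (intro mult_right_mono) auto
      finally have "exp (- c * s) * (2 * (D s \<bullet> D' s) - c * q s) - G\<^sup>2 \<le> 0" by simp
      moreover have "(\<phi> has_real_derivative exp (- c * s) * (2 * (D s \<bullet> D' s) - c * q s) - G\<^sup>2) (at s)"
        using d\<phi>[OF sT] at_within_Icc_at[of 0 s T] s t by auto
      ultimately show "\<exists>y. (\<phi> has_real_derivative y) (at s) \<and> y \<le> 0" by blast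
    next
      have "continuous_on {0..T} \<phi>"
        using DERIV_continuous[OF d\<phi>] by (auto simp: continuous_on_eq_continuous_within)
      then show "continuous_on {0..t} \<phi>" using t by (elim continuous_on_subset) auto
    qed (use t False in auto)
  qed simp
  then have "exp (- c * t) * q t \<le> q 0 + G\<^sup>2 * t" by (simp add: \<phi>_def)
  then have "q t \<le> exp (c * t) * (q 0 + G\<^sup>2 * t)"
    by (simp add: exp_minus field_simps)
  also have "\<dots> \<le> exp (c * T) * ((1 + T) * (norm (D 0) + G)\<^sup>2)"
  proof (rule mult_mono)
    show "exp (c * t) \<le> exp (c * T)" using t c by (auto intro: mult_left_mono)
    have "q 0 + G\<^sup>2 * t \<le> (norm (D 0))\<^sup>2 + G\<^sup>2 * T"
      using t by (auto simp: q_def power2_norm_eq_inner intro: mult_left_mono)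
    also have "\<dots> \<le> (1 + T) * ((norm (D 0))\<^sup>2 + G\<^sup>2)"
      using T by (simp add: algebra_simps)
    also have "\<dots> \<le> (1 + T) * (norm (D 0) + G)\<^sup>2"
      using T G by (intro mult_left_mono) (auto simp: power2_sum)
    finally show "q 0 + G\<^sup>2 * t \<le> (1 + T) * (norm (D 0) + G)\<^sup>2" .
  qed (use t q_def in auto)
  finally have "(norm (D t))\<^sup>2 \<le> (sqrt ((1 + T) * exp (c * T)) * (norm (D 0) + G))\<^sup>2"
    using T by (simp add: q_def power2_norm_eq_inner power_mult_distrib mult_ac)
  then show ?thesis
    unfolding c_def by (rule power2_le_imp_le) (use G T in auto)
qed

lemma norm_matrix_vector_mult_le:
  fixes A :: "real^'n^'m"
  shows "norm (A *v v) \<le> norm A * norm v"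
proof -
  have "norm (A *v v) \<le> L2_set (\<lambda>i. norm (A $ i) * norm v) UNIV"
    unfolding norm_vec_def[of "A *v v"]
    by (intro L2_set_mono) (auto simp: matrix_vector_mul_component Cauchy_Schwarz_ineq2)
  also have "\<dots> = norm A * norm v"
    by (simp add: L2_set_left_distrib norm_vec_def[of A])
  finally show ?thesis .
qed

lemma bounded_bilinear_matrix_vector_mult:
  "bounded_bilinear ((*v) :: real^'n^'m \<Rightarrow> real^'n \<Rightarrow> real^'m)"
proof
  show "\<exists>K. \<forall>A v. norm (A *v v :: real^'m) \<le> norm (A :: real^'n^'m) * norm v * K"
    by (intro exI[of _ 1]) (simp add: norm_matrix_vector_mult_le)
qed (simp_all add: matrix_vector_mult_add_rdistrib matrix_vector_right_distrib
    matrix_vector_mult_scaleR scaleR_matrix_vector_assoc)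

lemma periodic_int_mult:
  assumes "periodic T x"
  shows "x (t + of_int k * T) = x t"
proof (induction k arbitrary: t rule: int_induct[of _ 0])
  case (step1 k)
  have "x (t + of_int (k + 1) * T) = x ((t + of_int k * T) + T)" by (simp add: algebra_simps)
  then show ?case using assms step1 by (simp add: periodic_def)
next
  case (step2 k)
  have "x (t + of_int (k - 1) * T) = x ((t + of_int (k - 1) * T) + T)" using assms by (simp add: periodic_def)
  also have "(t + of_int (k - 1) * T) + T = t + of_int k * T" by (simp add: algebra_simps)
  finally show ?case using step2 by simp
qed simp

text \<open>One representative \<open>s\<close> serves all \<open>T\<close>-periodic functions at once, so that it can be used for a
solution and for the cycle simultaneously.\<close>

lemma periodic_eq_on_period:
  assumes "T > 0" "periodic T x"
  obtains s where "s \<in> {0..T}" "\<And>y. periodic T y \<Longrightarrow> y t = y s"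
proof (rule that[of "t - of_int \<lfloor>t / T\<rfloor> * T"])
  show "t - of_int \<lfloor>t / T\<rfloor> * T \<in> {0..T}"
    using assms(1) floor_divide_lower[of T t] floor_divide_upper[of T t] by (auto simp: algebra_simps)
  show "y t = y (t - of_int \<lfloor>t / T\<rfloor> * T)" if "periodic T y" for y
    using periodic_int_mult[OF that, of "t - of_int \<lfloor>t / T\<rfloor> * T" "\<lfloor>t / T\<rfloor>"] by simp
qed

lemma periodic_extension_solves_ode:
  fixes X :: "real \<Rightarrow> 'a::real_normed_vector"
  assumes T: "T > 0" and F: "\<And>v. periodic T (\<lambda>t. F t v)"
    and X: "\<And>t. t \<in> {0..T} \<Longrightarrow> (X has_vector_derivative F t (X t)) (at t within {0..T})"
    and XT: "X T = X 0"
  obtains Y where "periodic T Y" "solves_ode F Y" "\<And>t. t \<in> {0..T} \<Longrightarrow> Y t = X t"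
proof -
  define Y where "Y t = X (t - of_int \<lfloor>t / T\<rfloor> * T)" for t
  have Y: "Y t = X (t - of_int k * T)" if "t \<in> {of_int k * T..of_int (k + 1) * T}" for t k
  proof (cases "t = of_int (k + 1) * T")
    case True
    then have "\<lfloor>t / T\<rfloor> = k + 1" using T by simp
    then show ?thesis using True XT by (simp add: Y_def algebra_simps)
  next
    case False
    then have "\<lfloor>t / T\<rfloor> = k" using that T by (intro floor_unique) (auto simp: field_simps)
    then show ?thesis by (simp add: Y_def)
  qed
  have per: "periodic T Y"
  proof -
    have "\<lfloor>(t + T) / T\<rfloor> = \<lfloor>t / T\<rfloor> + 1" for t using T by (simp add: add_divide_distrib)
    then show ?thesis by (simp add: periodic_def Y_def algebra_simps)
  qed
  have within: "(Y has_vector_derivative F t (Y t)) (at t within {of_int k * T..of_int (k + 1) * T})"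
    if t: "t \<in> {of_int k * T..of_int (k + 1) * T}" for t k
  proof -
    let ?I = "{of_int k * T..of_int (k + 1) * T}" and ?\<tau> = "\<lambda>t. t - of_int k * T"
    have "?\<tau> t \<in> {0..T}" "?\<tau> ` ?I \<subseteq> {0..T}" using t by (auto simp: algebra_simps)
    then have "(X has_vector_derivative F (?\<tau> t) (X (?\<tau> t))) (at (?\<tau> t) within ?\<tau> ` ?I)"
      using X has_vector_derivative_within_subset by blast
    moreover have "(?\<tau> has_vector_derivative 1) (at t within ?I)"
      by (auto intro!: derivative_eq_intros)
    ultimately have "((X \<circ> ?\<tau>) has_vector_derivative 1 *\<^sub>R F (?\<tau> t) (X (?\<tau> t))) (at t within ?I)"
      by (rule vector_diff_chain_within[rotated])
    moreover have "F (?\<tau> t) (X (?\<tau> t)) = F t (Y t)"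
      using periodic_int_mult[OF F, of "?\<tau> t" k "Y t"] Y[OF t] by simp
    ultimately show ?thesis
      using has_vector_derivative_transform[OF t, of Y "X \<circ> ?\<tau>"] Y by auto
  qed
  have "(Y has_vector_derivative F t (Y t)) (at t)" for t
  proof -
    define k where "k = \<lfloor>t / T\<rfloor>"
    have k: "of_int k * T \<le> t" "t < of_int (k + 1) * T"
      using T floor_divide_lower[of T t] floor_divide_upper[of T t] by (auto simp: k_def algebra_simps)
    show ?thesis
    proof (cases "t = of_int k * T")
      case False
      then show ?thesis
        using within[of t k] k at_within_Icc_at[of "of_int k * T" t "of_int (k + 1) * T"] by auto
    next
      case True
      let ?A = "{of_int (k - 1) * T..of_int k * T}" and ?B = "{of_int k * T..of_int (k + 1) * T}"
      have "(Y has_vector_derivative F t (Y t)) (at t within ?A)"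
           "(Y has_vector_derivative F t (Y t)) (at t within ?B)"
        using within[of t "k - 1"] within[of t k] True T by (auto simp: algebra_simps)
      then have "(Y has_vector_derivative F t (Y t)) (at t within ?A \<union> ?B)"
        unfolding has_vector_derivative_def has_derivative_within using Lim_Un by blast
      moreover have "?A \<union> ?B = {of_int (k - 1) * T..of_int (k + 1) * T}"
        using T by (auto simp: algebra_simps)
      ultimately show ?thesis
        using at_within_Icc_at[of "of_int (k - 1) * T" t "of_int (k + 1) * T"] True T
        by (auto simp: algebra_simps)
    qed
  qed
  then have "solves_ode F Y" by (simp add: solves_ode_def)
  moreover have "Y t = X t" if "t \<in> {0..T}" for t using Y[of t 0] that by simp
  ultimately show thesis using that per by blast
qed

section \<open>Simple multipliers\<close>

lemma poly_det:
  fixes A :: "real poly^'n^'n"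
  shows "poly (det A) s = det (\<chi> i j. poly (A $ i $ j) s)"
  by (simp add: det_def poly_sum poly_prod)

lemma char_polynomial_nonzero:
  fixes W :: "real^'n^'n"
  shows "char_polynomial W \<noteq> 0"
proof
  assume 0: "char_polynomial W = 0"
  define s where "s = onorm ((*v) W) + 1"
  let ?A = "(\<chi> i j. (if i = j then s else 0) - W $ i $ j) :: real^'n^'n"
  have Av: "?A *v v = s *\<^sub>R v - W *v v" for v
  proof -
    have "((if i = j then s else 0) - W $ i $ j) * v $ j
        = (if i = j then s * v $ j else 0) - W $ i $ j * v $ j" for i j
      by (simp add: left_diff_distrib)
    then show ?thesis by (simp add: vec_eq_iff matrix_vector_mult_def sum_subtractf)
  qed
  have "poly (char_polynomial W) s = det ?A"
    unfolding char_polynomial_def poly_det by (intro arg_cong[where f = det]) (simp add: vec_eq_iff)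
  then have "det ?A = 0" using 0 by simp
  then obtain v where v: "v \<noteq> 0" "?A *v v = 0"
    using invertible_det_nz[of ?A] matrix_left_invertible_ker[of ?A] invertible_left_inverse[of ?A] by auto
  then have "W *v v = s *\<^sub>R v" by (simp add: Av)
  then have "norm (s *\<^sub>R v) \<le> onorm ((*v) W) * norm v"
    using onorm[OF matrix_vector_mul_bounded_linear, of W v] by simp
  then have "\<bar>s\<bar> \<le> onorm ((*v) W)" using v by simp
  then show False by (simp add: s_def)
qed

text \<open>Geometric multiplicity is bounded by algebraic multiplicity. In a basis \<open>b\<close> that contains \<open>e\<close>
and \<open>v\<close>, the rows of \<open>P (X I - W)\<^sup>T\<close> that belong to these two vectors are divisible by \<open>X - 1\<close>,
and the determinant of \<open>P\<close> does not vanish.\<close>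

lemma order_char_polynomial_ge_2:
  fixes W :: "real^'n^'n"
  assumes ind: "independent {e, v}" "e \<noteq> v" and e: "W *v e = e" and v: "W *v v = v"
  shows "order 1 (char_polynomial W) \<ge> 2"
proof -
  define C where "C = extend_basis {e, v}"
  have C: "independent C" "span C = UNIV" "{e, v} \<subseteq> C"
    using independent_extend_basis[OF ind(1)] span_extend_basis[OF ind(1)] extend_basis_superset[OF ind(1)]
    by (auto simp: C_def)
  have "card C = CARD('n)" using basis_card_eq_dim[of C UNIV] C by simp
  then obtain b where b: "bij_betw b (UNIV :: 'n set) C"
    using finite_same_card_bij[of "UNIV :: 'n set" C] independent_imp_finite[OF C(1)] by auto
  then obtain i0 i1 where i: "b i0 = e" "b i1 = v"
    using C(3) unfolding bij_betw_def by (metis imageE insert_subset)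
  have ne: "i0 \<noteq> i1" using i ind(2) by auto
  define P where "P = ((\<chi> i. b i) :: real^'n^'n)"
  have "rows P = C" using b by (auto simp: rows_def row_def P_def bij_betw_def)
  then have "\<exists>B. B ** P = mat 1" using matrix_left_invertible_span_rows[of P] C by simp
  then have detP: "det P \<noteq> 0" by (simp add: invertible_left_inverse[symmetric] invertible_det_nz)
  define K where "K = ((\<chi> i j. (if i = j then [:0, 1:] else 0) - [:W $ i $ j:]) :: real poly^'n^'n)"
  define Pp where "Pp = ((\<chi> i j. [:P $ i $ j:]) :: real poly^'n^'n)"
  define a where "a i = ((\<chi> j. [:b i $ j:]) :: real poly^'n)" for i
  define Q where "Q = Pp ** transpose K"
  have Q: "Q $ i $ j = [:0, 1:] * [:b i $ j:] - [:(W *v b i) $ j:]" for i j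
  proof -
    have c: "(\<Sum>k\<in>UNIV. [:g k:]) = [:\<Sum>k\<in>UNIV. g k:]" for g :: "'n \<Rightarrow> real"
      by (simp add: poly_eq_iff coeff_sum coeff_pCons split: nat.split)
    have "Q $ i $ j = (\<Sum>k\<in>UNIV. [:b i $ k:] * (if j = k then [:0, 1:] else 0)) - (\<Sum>k\<in>UNIV. [:W $ j $ k * b i $ k:])"
      by (simp add: Q_def matrix_matrix_mult_def Pp_def P_def K_def transpose_def right_diff_distrib
          sum_subtractf mult.commute)
    then show ?thesis
      unfolding c by (simp add: matrix_vector_mult_def if_distrib cong: if_cong)
  qed
  have row: "Q $ k = [:-1, 1:] *s a k" if "W *v b k = b k" for k
    using that by (simp add: vec_eq_iff Q a_def)
  define Q1 where "Q1 = ((\<chi> i. if i = i0 then a i else Q $ i) :: real poly^'n^'n)"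
  have "Q = (\<chi> i. if i = i0 then [:-1, 1:] *s a i else Q $ i)"
    using row[of i0] i e by (simp add: vec_eq_iff)
  then have d1: "det Q = [:-1, 1:] * det Q1"
    unfolding Q1_def using det_row_mul[of i0 "[:-1, 1:]" a "($) Q"] by simp
  have "Q1 = (\<chi> i. if i = i1 then [:-1, 1:] *s a i else Q1 $ i)"
    using row[of i1] i v ne by (simp add: vec_eq_iff Q1_def)
  then have d2: "det Q1 = [:-1, 1:] * det (\<chi> i. if i = i1 then a i else Q1 $ i)"
    using det_row_mul[of i1 "[:-1, 1:]" a "($) Q1"] by simp
  have dvd: "[:-1, 1:] ^ 2 dvd det Q"
    unfolding d1 d2 by (simp only: power2_eq_square mult.assoc[symmetric] dvd_triv_left)
  have "det Q = det Pp * char_polynomial W"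
    by (simp add: Q_def det_mul K_def char_polynomial_def)
  moreover have p1: "poly (det Pp) 1 \<noteq> 0"
    using detP by (simp add: poly_det Pp_def vec_lambda_eta)
  ultimately have "order 1 (det Q) = order 1 (char_polynomial W)" "det Q \<noteq> 0"
    using char_polynomial_nonzero[of W] by (auto simp: order_mult order_root)
  then show ?thesis using dvd order_divides[of 1 2 "det Q"] by simp
qed

lemma simple_multiplier_eigenspace:
  fixes W :: "real^'n^'n"
  assumes "order 1 (char_polynomial W) = 1" "W *v e = e" "e \<noteq> 0" "W *v v = v"
  obtains c where "v = c *\<^sub>R e"
proof -
  have "v \<in> span {e}"
  proof (rule ccontr)
    assume v: "v \<notin> span {e}"
    then have "independent {v, e}" using assms(3) by (simp add: independent_insert)
    moreover have "v \<noteq> e" using v span_base by blast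
    ultimately show False using order_char_polynomial_ge_2[of v e W] assms by simp
  qed
  then show thesis using that by (auto simp: span_singleton)
qed

text \<open>If the left and right eigenvectors \<open>w\<close> and \<open>e\<close> of a simple multiplier are not orthogonal, adding
the rank-one map \<open>v \<mapsto> (w \<bullet> v) e\<close> to \<open>W - I\<close> makes it invertible: pairing with \<open>w\<close> shows that a
vector in the kernel is orthogonal to \<open>w\<close> and fixed by \<open>W\<close>, hence a multiple of \<open>e\<close>, hence 0.\<close>

lemma bordered_inverse:
  fixes W :: "real^'n^'n"
  assumes simple: "order 1 (char_polynomial W) = 1"
    and e: "W *v e = e" and w: "\<And>v. w \<bullet> (W *v v) = w \<bullet> v" and we: "w \<bullet> e \<noteq> 0"
  obtains K where "linear K" "\<And>b. W *v K b - K b + (w \<bullet> K b) *\<^sub>R e = b"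
proof -
  define B where "B v = W *v v - v + (w \<bullet> v) *\<^sub>R e" for v
  have lin: "linear B"
    unfolding B_def
    by (intro linear_compose_add linear_compose_sub matrix_vector_mul_linear linear_ident
        bounded_linear.linear bounded_linear_inner_right bounded_linear_scaleR_left
        bounded_linear_compose[of "\<lambda>c. c *\<^sub>R e", OF bounded_linear_scaleR_left bounded_linear_inner_right, simplified])
  have "v = 0" if "B v = 0" for v
  proof -
    have "w \<bullet> B v = (w \<bullet> v) * (w \<bullet> e)" by (simp add: B_def inner_diff_right inner_add_right w)
    then have 0: "w \<bullet> v = 0" using that we by simp
    then have "W *v v = v" using that by (simp add: B_def)
    moreover have "e \<noteq> 0" using we by auto
    ultimately obtain c where "v = c *\<^sub>R e" using simple_multiplier_eigenspace[OF simple e] by metis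
    then show "v = 0" using 0 we by auto
  qed
  then have "inj B" using linear_injective_0[OF lin] by auto
  then have "surj B" using linear_injective_imp_surjective[OF lin] by simp
  then obtain K where "linear K" "B \<circ> K = id" using linear_surjective_right_inverse[OF lin] by auto
  then show thesis using that[of K] by (auto simp: B_def fun_eq_iff)
qed

section \<open>The cycle and its linearisation\<close>

lemma has_vector_derivative_matrix_vector_mult:
  fixes A :: "real \<Rightarrow> real^'n^'m"
  assumes "(A has_vector_derivative A') (at t within S)"
  shows "((\<lambda>t. A t *v v) has_vector_derivative A' *v v) (at t within S)"
  by (rule bounded_linear.has_vector_derivative[OF
      bounded_bilinear.bounded_linear_left[OF bounded_bilinear_matrix_vector_mult] assms])

text \<open>The fixed data of the bifurcation problem. The numbers \<open>\<rho>\<close>, \<open>L\<close>, \<open>G\<close> and \<open>Z\<close> exist by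
compactness; \<open>\<rho>\<close> leaves a margin of 1 around the cycle, inside which the perturbed solutions have to
stay.\<close>

locale perturbed_cycle =
  fixes f :: "real^'n \<Rightarrow> real^'n"
    and g :: "real \<Rightarrow> real^'n \<Rightarrow> real \<Rightarrow> real^'n"
    and x z :: "real \<Rightarrow> real^'n" and Y :: "real \<Rightarrow> real^'n^'n"
    and T \<rho> L G Z :: real
  assumes T: "T > 0"
    and f: "C1 f"
    and g: "continuous_on (UNIV \<times> UNIV \<times> {0..1}) (\<lambda>(t, v, \<epsilon>). g t v \<epsilon>)"
    and g_per: "\<And>v \<epsilon>. \<epsilon> \<in> {0..1} \<Longrightarrow> periodic T (\<lambda>t. g t v \<epsilon>)"
    and x: "solves_ode (\<lambda>t. f) x" and x_per: "periodic T x"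
    and Y: "solves_ode (\<lambda>t Z. jacobian f (at (x t)) ** Z) Y" and Y0: "Y 0 = mat 1"
    and simple: "order 1 (char_polynomial (Y T)) = 1"
    and z: "solves_ode (\<lambda>t v. - (transpose (jacobian f (at (x t))) *v v)) z"
    and z_per: "periodic T z"
    and transversal: "z 0 \<bullet> f (x 0) \<noteq> 0"
    and x_bound: "\<And>t. norm (x t) + 1 \<le> \<rho>"
    and f_bound: "\<And>v. norm v \<le> \<rho> \<Longrightarrow> norm (jacobian f (at v)) \<le> L"
    and g_bound: "\<And>t v \<epsilon>. norm v \<le> \<rho> \<Longrightarrow> \<epsilon> \<in> {0..1} \<Longrightarrow> norm (g t v \<epsilon>) \<le> G"
    and z_bound: "\<And>t. norm (z t) \<le> Z"
begin

abbreviation A :: "real \<Rightarrow> real^'n^'n" where "A t \<equiv> jacobian f (at (x t))"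

text \<open>The bifurcation function without its sign factor.\<close>

definition melnikov :: "real \<Rightarrow> real" where
  "melnikov \<theta> = integral {0..T} (\<lambda>\<tau>. z \<tau> \<bullet> g (\<tau> - \<theta>) (x \<tau>) 0)"

text \<open>The truncation makes the field bounded and globally Lipschitz up to terms of order \<open>\<epsilon>\<close>, so that all
a priori bounds hold without assuming first that solutions stay near the cycle.\<close>

definition clip :: "real^'n \<Rightarrow> real^'n" where
  "clip = closest_point (cball 0 \<rho>)"

text \<open>The factor in lemma \<open>gronwall_affine\<close>.\<close>

definition \<kappa> :: real where
  "\<kappa> = sqrt ((1 + T) * exp ((2 * L + 1) * T))"

text \<open>Time is shifted by \<open>\<theta>\<close>, which moves the phase into the first argument of \<open>g\<close>. All solutions are
compared with the same function \<open>x\<close>, and the linearisation, \<open>Y\<close> and \<open>z\<close> do not depend on \<open>\<theta>\<close>.\<close>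

definition clipped_solution :: "real \<Rightarrow> real \<Rightarrow> real^'n \<Rightarrow> (real \<Rightarrow> real^'n) \<Rightarrow> bool" where
  "clipped_solution \<theta> \<epsilon> v X \<longleftrightarrow> X 0 = x 0 + \<epsilon> *\<^sub>R v \<and>
     (\<forall>t\<in>{0..T}. (X has_vector_derivative f (clip (X t)) + \<epsilon> *\<^sub>R g (t - \<theta>) (clip (X t)) \<epsilon>)
        (at t within {0..T}))"

lemma \<rho>_pos: "\<rho> > 0" using x_bound[of 0] norm_ge_zero[of "x 0"] by linarith

lemma clip_in_cball: "norm (clip v) \<le> \<rho>"
  using closest_point_in_set[of "cball 0 \<rho>" v] \<rho>_pos by (simp add: clip_def)

lemma clip_id: "norm v \<le> \<rho> \<Longrightarrow> clip v = v"
  by (simp add: clip_def closest_point_self)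

lemma clip_lipschitz: "norm (clip v - clip w) \<le> norm (v - w)"
  using closest_point_lipschitz[of "cball 0 \<rho>" v w] \<rho>_pos by (simp add: clip_def dist_norm)

lemma continuous_clip: "continuous_on UNIV clip"
  unfolding clip_def using \<rho>_pos by (intro continuous_on_closest_point) auto

lemma L_nonneg: "0 \<le> L"
  using order_trans[OF norm_ge_zero f_bound[of 0]] \<rho>_pos by simp

lemma G_nonneg: "0 \<le> G"
  using order_trans[OF norm_ge_zero g_bound[of 0 0 0]] \<rho>_pos by simp

lemma Z_nonneg: "0 \<le> Z"
  using order_trans[OF norm_ge_zero z_bound[of 0]] .

lemma \<kappa>_pos: "0 < \<kappa>" using T by (simp add: \<kappa>_def)

lemma norm_x: "norm (x t) \<le> \<rho>" using x_bound[of t] by simp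

lemma f_derivative: "(f has_derivative (\<lambda>h. jacobian f (at v) *v h)) (at v within S)"
  using f by (auto simp: C1_def jacobian_works has_derivative_at_withinI)

lemma continuous_f: "continuous_on UNIV f"
  by (rule has_derivative_continuous_on[OF f_derivative])

lemma x_derivative: "(x has_vector_derivative f (x t)) (at t within S)"
  using x by (auto simp: solves_ode_def has_vector_derivative_at_within)

lemma continuous_x: "continuous_on S x"
  by (rule continuous_on_vector_derivative[OF x_derivative])

lemma z_derivative: "(z has_vector_derivative - (transpose (A t) *v z t)) (at t within S)"
  using z by (auto simp: solves_ode_def has_vector_derivative_at_within)

lemma continuous_z: "continuous_on S z"
  by (rule continuous_on_vector_derivative[OF z_derivative])

lemma Y_derivative: "((\<lambda>t. Y t *v v) has_vector_derivative A t *v (Y t *v v)) (at t within S)"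
proof -
  have "(Y has_vector_derivative A t ** Y t) (at t within S)"
    using Y by (auto simp: solves_ode_def has_vector_derivative_at_within)
  from has_vector_derivative_matrix_vector_mult[OF this, of v] show ?thesis
    by (simp add: matrix_vector_mul_assoc)
qed

lemma norm_A_mult: "norm (A t *v h) \<le> L * norm h"
  using norm_matrix_vector_mult_le[of "A t" h] mult_right_mono[OF f_bound[OF norm_x[of t]], of "norm h"]
  by simp

lemma continuous_g:
  assumes "continuous_on S a" "continuous_on S b" "continuous_on S c" "\<And>s. s \<in> S \<Longrightarrow> c s \<in> {0..1}"
  shows "continuous_on S (\<lambda>s. g (a s) (b s) (c s))"
proof -
  have "continuous_on S ((\<lambda>(t, v, \<epsilon>). g t v \<epsilon>) \<circ> (\<lambda>s. (a s, b s, c s)))"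
    using assms by (intro continuous_on_compose continuous_intros continuous_on_subset[OF g]) auto
  then show ?thesis by (simp add: o_def)
qed

lemma f_lipschitz:
  assumes "norm v \<le> \<rho>" "norm w \<le> \<rho>"
  shows "norm (f v - f w) \<le> L * norm (v - w)"
proof (rule differentiable_bound[of "cball 0 \<rho>"])
  show "(f has_derivative (\<lambda>h. jacobian f (at v) *v h)) (at v within cball 0 \<rho>)" for v
    by (rule f_derivative)
  show "onorm (\<lambda>h. jacobian f (at v) *v h) \<le> L" if "v \<in> cball 0 \<rho>" for v
  proof (rule onorm_le)
    show "norm (jacobian f (at v) *v h) \<le> L * norm h" for h
      using norm_matrix_vector_mult_le[of "jacobian f (at v)" h] that
        mult_right_mono[OF f_bound[of v], of "norm h"] by simp
  qed
qed (use assms in auto)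

lemma f_linearization:
  assumes "\<eta> > 0"
  obtains \<delta> where "\<delta> > 0" "\<And>t h. norm h < \<delta> \<Longrightarrow> norm (x t + h) \<le> \<rho> \<Longrightarrow>
      norm (f (x t + h) - f (x t) - A t *v h) \<le> \<eta> * norm h"
proof -
  have "uniformly_continuous_on (cball 0 \<rho>) (\<lambda>v. jacobian f (at v))"
    using f by (intro compact_uniformly_continuous) (auto simp: C1_def intro: continuous_on_subset)
  then obtain \<delta> where "\<delta> > 0" and \<delta>: "\<And>v w. v \<in> cball 0 \<rho> \<Longrightarrow> w \<in> cball 0 \<rho> \<Longrightarrow> dist v w < \<delta> \<Longrightarrow>
      dist (jacobian f (at v)) (jacobian f (at w)) < \<eta>"
    using assms unfolding uniformly_continuous_on_def by metis
  show thesis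
  proof (rule that[OF \<open>\<delta> > 0\<close>])
    fix t h assume h: "norm h < \<delta>" "norm (x t + h) \<le> \<rho>"
    define S where "S = cball 0 \<rho> \<inter> ball (x t) \<delta>"
    have "x t + h \<in> ball (x t) \<delta>" "x t + h \<in> cball 0 \<rho>" using h by (simp add: dist_norm, simp)
    then have ends: "x t \<in> S" "x t + h \<in> S" using norm_x[of t] \<open>\<delta> > 0\<close> by (auto simp: S_def)
    have "convex S" by (simp add: S_def convex_Int)
    have "norm (f (x t + h) - f (x t) - A t *v ((x t + h) - x t)) \<le> norm ((x t + h) - x t) * \<eta>"
    proof (rule differentiable_bound_linearization[of _ _ S f "\<lambda>v h. jacobian f (at v) *v h" "x t"])
      show "x t + s *\<^sub>R (x t + h - x t) \<in> S" if "s \<in> {0..1}" for s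
        using convexD_alt[OF \<open>convex S\<close> ends, of s] that by (simp add: algebra_simps)
      show "(f has_derivative (\<lambda>h. jacobian f (at v) *v h)) (at v within S)" for v
        by (rule f_derivative)
      show "onorm ((\<lambda>h. jacobian f (at v) *v h) - (\<lambda>h. A t *v h)) \<le> \<eta>" if "v \<in> S" for v
      proof (rule onorm_le)
        fix h
        have "norm (jacobian f (at v) - A t) \<le> \<eta>"
          using \<delta>[of v "x t"] that ends by (auto simp: S_def dist_norm norm_minus_commute)
        then have "norm ((jacobian f (at v) - A t) *v h) \<le> \<eta> * norm h"
          using norm_matrix_vector_mult_le[of "jacobian f (at v) - A t" h]
            mult_right_mono[of _ \<eta> "norm h"] by (meson norm_ge_zero order_trans)
        then show "norm (((\<lambda>h. jacobian f (at v) *v h) - (\<lambda>h. A t *v h)) h) \<le> \<eta> * norm h"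
          by (simp add: matrix_vector_mult_diff_rdistrib)
      qed
    qed (use ends in auto)
    then show "norm (f (x t + h) - f (x t) - A t *v h) \<le> \<eta> * norm h"
      by (simp add: mult.commute)
  qed
qed

text \<open>The reason why the adjoint solution detects solvability: pairing with it removes the
homogeneous part of the linearised equation.\<close>

lemma adjoint_pairing:
  assumes "(u has_vector_derivative A t *v u t + p) (at t within S)"
  shows "((\<lambda>t. z t \<bullet> u t) has_vector_derivative z t \<bullet> p) (at t within S)"
proof -
  have "((\<lambda>t. z t \<bullet> u t) has_vector_derivative
      z t \<bullet> (A t *v u t + p) + - (transpose (A t) *v z t) \<bullet> u t) (at t within S)"
    by (rule bounded_bilinear.has_vector_derivative[OF bounded_bilinear_inner z_derivative assms])
  then show ?thesis by (simp add: inner_add_right dot_lmul_matrix)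
qed

lemma pairing_monodromy: "z 0 \<bullet> (Y T *v v) = z 0 \<bullet> v"
proof -
  have "((\<lambda>t. z t \<bullet> (Y t *v v)) has_vector_derivative 0) (at t within {0..T})" for t
    using adjoint_pairing[of "\<lambda>t. Y t *v v" t 0] Y_derivative[of v t] by simp
  then have "((\<lambda>t. 0) has_integral z T \<bullet> (Y T *v v) - z 0 \<bullet> (Y 0 *v v)) {0..T}"
    using T by (intro fundamental_theorem_of_calculus) auto
  then have "z T \<bullet> (Y T *v v) - z 0 \<bullet> (Y 0 *v v) = 0"
    by (simp add: has_integral_0_eq)
  moreover have "z T = z 0" using z_per[unfolded periodic_def, rule_format, of 0] by simp
  ultimately show ?thesis by (simp add: Y0)
qed

lemma x_T: "x T = x 0" using x_per[unfolded periodic_def, rule_format, of 0] by simp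

lemma monodromy_velocity: "Y T *v f (x 0) = f (x 0)"
proof -
  let ?D = "\<lambda>t. f (x t) - Y t *v f (x 0)"
  have "((\<lambda>t. f (x t)) has_vector_derivative A t *v f (x t)) (at t within {0..T})" for t
    using vector_derivative_diff_chain_within[OF x_derivative f_derivative, of t "{0..T}"]
    by (simp add: o_def)
  then have "(?D has_vector_derivative A t *v ?D t) (at t within {0..T})" for t
    by (auto intro!: derivative_eq_intros Y_derivative simp: matrix_vector_mult_diff_distrib)
  then have "norm (?D T) \<le> \<kappa> * (norm (?D 0) + 0)"
    unfolding \<kappa>_def using T L_nonneg norm_A_mult
    by (intro gronwall_affine[where D' = "\<lambda>t. A t *v ?D t"]) auto
  then show ?thesis by (simp add: Y0 x_T)
qed

lemma clipped_solution_deviation: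
  assumes X: "clipped_solution \<theta> \<epsilon> v X" and \<epsilon>: "\<epsilon> \<in> {0..1}" and t: "t \<in> {0..T}"
  shows "norm (X t - x t) \<le> \<epsilon> * (\<kappa> * (norm v + G))"
proof -
  let ?D' = "\<lambda>t. f (clip (X t)) + \<epsilon> *\<^sub>R g (t - \<theta>) (clip (X t)) \<epsilon> - f (x t)"
  have "norm (X t - x t) \<le> \<kappa> * (norm (X 0 - x 0) + \<epsilon> * G)"
    unfolding \<kappa>_def
  proof (rule gronwall_affine[where D' = ?D'])
    fix t assume t: "t \<in> {0..T}"
    show "((\<lambda>t. X t - x t) has_vector_derivative ?D' t) (at t within {0..T})"
      using X t by (intro has_vector_derivative_diff x_derivative) (auto simp: clipped_solution_def)
    have "norm (?D' t) \<le> norm (f (clip (X t)) - f (clip (x t))) + norm (\<epsilon> *\<^sub>R g (t - \<theta>) (clip (X t)) \<epsilon>)"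
      using norm_triangle_ineq[of "f (clip (X t)) - f (x t)" "\<epsilon> *\<^sub>R g (t - \<theta>) (clip (X t)) \<epsilon>"]
      by (simp add: clip_id norm_x algebra_simps)
    also have "\<dots> \<le> L * norm (clip (X t) - clip (x t)) + \<epsilon> * G"
      using \<epsilon> g_bound clip_in_cball by (intro add_mono f_lipschitz) (auto intro: mult_left_mono)
    also have "\<dots> \<le> L * norm (X t - x t) + \<epsilon> * G"
      using L_nonneg clip_lipschitz by (intro add_mono[OF mult_left_mono order_refl]) auto
    finally show "norm (?D' t) \<le> L * norm (X t - x t) + \<epsilon> * G" .
  qed (use L_nonneg G_nonneg \<epsilon> t in auto)
  also have "\<dots> = \<epsilon> * (\<kappa> * (norm v + G))"
    using X \<epsilon> by (simp add: clipped_solution_def algebra_simps)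
  finally show ?thesis .
qed

section \<open>First-order expansion of the perturbed solutions\<close>


text \<open>For \<open>V = (X - x) / \<epsilon>\<close> one has \<open>V' = A V + g (t - \<theta>) (x t) 0 + q\<close>, and the left-hand side of the
estimate is the norm of \<open>q\<close>. Since \<open>V\<close> is bounded, \<open>X - x\<close> is \<open>O(\<epsilon>)\<close>, so that the first-order
Taylor remainder of \<open>f\<close> is \<open>o(\<epsilon>)\<close> although \<open>f\<close> is only \<open>C\<^sup>1\<close>.\<close>

lemma rescaled_remainder_small:
  assumes \<eta>: "\<eta> > 0" and R: "R \<ge> 0"
  obtains \<epsilon>0 where "\<epsilon>0 > 0" "\<epsilon>0 \<le> 1"
    "\<And>\<epsilon> \<theta> v X t. \<lbrakk>0 < \<epsilon>; \<epsilon> < \<epsilon>0; \<theta> \<in> {a..b}; norm v \<le> R; clipped_solution \<theta> \<epsilon> v X; t \<in> {0..T}\<rbrakk>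
      \<Longrightarrow> norm (X t) \<le> \<rho> \<and>
        norm ((1 / \<epsilon>) *\<^sub>R (f (X t) - f (x t) - A t *v (X t - x t))
          + (g (t - \<theta>) (X t) \<epsilon> - g (t - \<theta>) (x t) 0)) \<le> \<eta>"
proof -
  define C where "C = \<kappa> * (R + G)"
  have C: "C \<ge> 0" using \<kappa>_pos R G_nonneg by (simp add: C_def)
  define \<eta>' where "\<eta>' = \<eta> / (2 * (C + 1))"
  have \<eta>': "\<eta>' > 0" "\<eta>' * C \<le> \<eta> / 2" using \<eta> C by (auto simp: \<eta>'_def field_simps)
  obtain \<delta> where \<delta>: "\<delta> > 0" and lin: "\<And>t h. norm h < \<delta> \<Longrightarrow> norm (x t + h) \<le> \<rho> \<Longrightarrow>
      norm (f (x t + h) - f (x t) - A t *v h) \<le> \<eta>' * norm h"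
    using f_linearization[OF \<eta>'(1)] by blast
  let ?K = "{- b..T - a} \<times> cball 0 \<rho> \<times> {0..1::real}"
  have "uniformly_continuous_on ?K (\<lambda>(t, v, \<epsilon>). g t v \<epsilon>)"
    by (intro compact_uniformly_continuous continuous_on_subset[OF g] compact_Times) auto
  then obtain \<delta>' where \<delta>': "\<delta>' > 0" and unif: "\<And>p q. p \<in> ?K \<Longrightarrow> q \<in> ?K \<Longrightarrow> dist p q < \<delta>' \<Longrightarrow>
      dist ((\<lambda>(t, v, \<epsilon>). g t v \<epsilon>) p) ((\<lambda>(t, v, \<epsilon>). g t v \<epsilon>) q) < \<eta> / 2"
    using \<eta> unfolding uniformly_continuous_on_def by (metis half_gt_zero)
  define m where "m = min 1 (min \<delta> \<delta>')"
  have m: "m > 0" "m \<le> 1" "m \<le> \<delta>" "m \<le> \<delta>'" using \<delta> \<delta>' by (auto simp: m_def)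
  show thesis
  proof (rule that[of "m / (C + 1)"])
    show "m / (C + 1) > 0" "m / (C + 1) \<le> 1" using m C by (auto simp: field_simps)
    fix \<epsilon> \<theta> v X t
    assume \<epsilon>: "0 < \<epsilon>" "\<epsilon> < m / (C + 1)" and \<theta>: "\<theta> \<in> {a..b}" and v: "norm v \<le> R"
      and X: "clipped_solution \<theta> \<epsilon> v X" and t: "t \<in> {0..T}"
    have \<epsilon>m: "\<epsilon> * C + \<epsilon> < m" using \<epsilon> C by (simp add: field_simps)
    have \<epsilon>C: "0 \<le> \<epsilon> * C" using \<epsilon> C by simp
    have \<epsilon>1: "\<epsilon> \<in> {0..1}" using \<epsilon> \<epsilon>m \<epsilon>C m(2) by auto
    have "norm (X t - x t) \<le> \<epsilon> * (\<kappa> * (norm v + G))"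
      by (rule clipped_solution_deviation[OF X \<epsilon>1 t])
    also have "\<dots> \<le> \<epsilon> * C"
      unfolding C_def using \<epsilon> \<kappa>_pos v by (intro mult_left_mono) auto
    finally have dev: "norm (X t - x t) \<le> \<epsilon> * C" .
    have X\<rho>: "norm (X t) \<le> \<rho>"
      using norm_triangle_ineq[of "x t" "X t - x t"] dev x_bound[of t] \<epsilon>m \<epsilon> m by simp
    have "norm (f (x t + (X t - x t)) - f (x t) - A t *v (X t - x t)) \<le> \<eta>' * norm (X t - x t)"
      using dev \<epsilon>m \<epsilon> m X\<rho> by (intro lin) auto
    also have "\<dots> \<le> \<eta>' * (\<epsilon> * C)" using \<eta>'(1) dev by (intro mult_left_mono) auto
    also have "\<dots> = \<epsilon> * (\<eta>' * C)" by simp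
    also have "\<dots> \<le> \<epsilon> * (\<eta> / 2)" using \<eta>'(2) \<epsilon> by (intro mult_left_mono) auto
    finally have "norm (f (X t) - f (x t) - A t *v (X t - x t)) \<le> \<epsilon> * (\<eta> / 2)" by simp
    then have 1: "norm ((1 / \<epsilon>) *\<^sub>R (f (X t) - f (x t) - A t *v (X t - x t))) \<le> \<eta> / 2"
      unfolding norm_scaleR using \<epsilon> by (simp add: pos_divide_le_eq mult.commute)
    have "dist (t - \<theta>, X t, \<epsilon>) (t - \<theta>, x t, 0::real) \<le> dist (X t) (x t) + dist \<epsilon> 0"
      using sqrt_sum_squares_le_sum_abs[of "dist (X t) (x t)" "dist \<epsilon> 0"]
      by (simp add: dist_Pair_Pair)
    also have "\<dots> < \<delta>'" using dev \<epsilon>m \<epsilon> m by (simp add: dist_norm)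
    finally have "dist (g (t - \<theta>) (X t) \<epsilon>) (g (t - \<theta>) (x t) 0) < \<eta> / 2"
      using unif[of "(t - \<theta>, X t, \<epsilon>)" "(t - \<theta>, x t, 0)"] \<theta> t X\<rho> norm_x \<epsilon>1 by auto
    with 1 show "norm (X t) \<le> \<rho> \<and>
        norm ((1 / \<epsilon>) *\<^sub>R (f (X t) - f (x t) - A t *v (X t - x t))
          + (g (t - \<theta>) (X t) \<epsilon> - g (t - \<theta>) (x t) 0)) \<le> \<eta>"
      using X\<rho> norm_triangle_ineq[of "(1 / \<epsilon>) *\<^sub>R (f (X t) - f (x t) - A t *v (X t - x t))"
          "g (t - \<theta>) (X t) \<epsilon> - g (t - \<theta>) (x t) 0"] unfolding dist_norm by linarith
  qed
qed

lemma melnikov_has_integral: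
  "((\<lambda>\<tau>. z \<tau> \<bullet> g (\<tau> - \<theta>) (x \<tau>) 0) has_integral melnikov \<theta>) {0..T}"
proof -
  have "continuous_on {0..T} (\<lambda>\<tau>. g (\<tau> - \<theta>) (x \<tau>) 0)"
    by (rule continuous_g) (auto intro: continuous_x intro!: continuous_on_diff)
  then have "continuous_on {0..T} (\<lambda>\<tau>. z \<tau> \<bullet> g (\<tau> - \<theta>) (x \<tau>) 0)"
    by (rule continuous_on_inner[OF continuous_z])
  then show ?thesis
    unfolding melnikov_def by (intro integrable_integral integrable_continuous_interval)
qed

lemma continuous_melnikov: "continuous_on S melnikov"
proof -
  have "continuous_on (UNIV \<times> cbox 0 T) (\<lambda>(\<theta>, \<tau>). z \<tau> \<bullet> g (\<tau> - \<theta>) (x \<tau>) 0)"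
  proof -
    have "continuous_on (UNIV \<times> cbox 0 T) (\<lambda>p. g (snd p - fst p) (x (snd p)) 0)"
      by (rule continuous_g) (auto intro!: continuous_intros continuous_on_compose2[OF continuous_x[of UNIV]])
    then have "continuous_on (UNIV \<times> cbox 0 T) (\<lambda>p. z (snd p) \<bullet> g (snd p - fst p) (x (snd p)) 0)"
      by (intro continuous_on_inner continuous_on_compose2[OF continuous_z[of UNIV]] continuous_on_snd
          continuous_on_id) auto
    then show ?thesis by (simp add: case_prod_beta)
  qed
  then have "continuous_on UNIV melnikov"
    unfolding melnikov_def[abs_def] using integral_continuous_on_param by fastforce
  then show ?thesis by (rule continuous_on_subset) simp
qed

text \<open>The bound for the part of the endpoint that is not explained by \<open>v\<close> does not involve \<open>R\<close>; hence \<open>R\<close> can be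
chosen afterwards, large enough for the truncation of \<open>v\<close> in the shooting map to be inactive.
The last estimate identifies the component of the defect along the adjoint
solution: it is the integral that defines the bifurcation function, up to a small error.\<close>

lemma first_order_expansion:
  assumes \<eta>: "\<eta> > 0" and R: "R \<ge> 0"
  obtains \<epsilon>0 where "\<epsilon>0 > 0" "\<epsilon>0 \<le> 1"
    "\<And>\<epsilon> \<theta> v X t. \<lbrakk>0 < \<epsilon>; \<epsilon> < \<epsilon>0; \<theta> \<in> {a..b}; norm v \<le> R; clipped_solution \<theta> \<epsilon> v X; t \<in> {0..T}\<rbrakk>
      \<Longrightarrow> norm (X t) \<le> \<rho>"
    "\<And>\<epsilon> \<theta> v X. \<lbrakk>0 < \<epsilon>; \<epsilon> < \<epsilon>0; \<theta> \<in> {a..b}; norm v \<le> R; clipped_solution \<theta> \<epsilon> v X\<rbrakk>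
      \<Longrightarrow> norm ((1 / \<epsilon>) *\<^sub>R (X T - x T) - Y T *v v) \<le> \<kappa> * (G + 1)"
    "\<And>\<epsilon> \<theta> v X. \<lbrakk>0 < \<epsilon>; \<epsilon> < \<epsilon>0; \<theta> \<in> {a..b}; norm v \<le> R; clipped_solution \<theta> \<epsilon> v X\<rbrakk>
      \<Longrightarrow> \<bar>z 0 \<bullet> ((1 / \<epsilon>) *\<^sub>R (X T - x T) - v) - melnikov \<theta>\<bar> \<le> \<eta>"
proof -
  define \<mu> where "\<mu> = min 1 (\<eta> / (Z * T + 1))"
  have ZT: "0 \<le> Z * T" using Z_nonneg T by simp
  have \<mu>: "0 < \<mu>" "\<mu> \<le> 1" using \<eta> ZT by (auto simp: \<mu>_def)
  have "Z * \<mu> * T \<le> \<mu> * (Z * T + 1)" using \<mu> by (simp add: algebra_simps)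
  also have "\<dots> \<le> \<eta>"
  proof -
    have "\<mu> \<le> \<eta> / (Z * T + 1)" by (simp add: \<mu>_def)
    then show ?thesis using ZT by (simp add: pos_le_divide_eq)
  qed
  finally have \<mu>Z: "Z * \<mu> * T \<le> \<eta>" .
  obtain \<epsilon>0 where \<epsilon>0: "\<epsilon>0 > 0" "\<epsilon>0 \<le> 1"
    and rem: "\<And>\<epsilon> \<theta> v X t. \<lbrakk>0 < \<epsilon>; \<epsilon> < \<epsilon>0; \<theta> \<in> {a..b}; norm v \<le> R; clipped_solution \<theta> \<epsilon> v X; t \<in> {0..T}\<rbrakk>
      \<Longrightarrow> norm (X t) \<le> \<rho> \<and>
        norm ((1 / \<epsilon>) *\<^sub>R (f (X t) - f (x t) - A t *v (X t - x t))
          + (g (t - \<theta>) (X t) \<epsilon> - g (t - \<theta>) (x t) 0)) \<le> \<mu>"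
    by (rule rescaled_remainder_small[OF \<mu>(1) R, of a b]) (rule that, assumption+)
  show thesis
  proof (rule that[OF \<epsilon>0])
    fix \<epsilon> \<theta> v X assume hyp: "0 < \<epsilon>" "\<epsilon> < \<epsilon>0" "\<theta> \<in> {a..b}" "norm v \<le> R" "clipped_solution \<theta> \<epsilon> v X"
    show X\<rho>: "norm (X t) \<le> \<rho>" if "t \<in> {0..T}" for t using rem[OF hyp that] by simp
    define V where "V t = (1 / \<epsilon>) *\<^sub>R (X t - x t)" for t
    define q where "q t = (1 / \<epsilon>) *\<^sub>R (f (X t) - f (x t) - A t *v (X t - x t))
          + (g (t - \<theta>) (X t) \<epsilon> - g (t - \<theta>) (x t) 0)" for t
    have q: "norm (q t) \<le> \<mu>" if "t \<in> {0..T}" for t using rem[OF hyp that] by (simp add: q_def)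
    have V0: "V 0 = v" using hyp by (simp add: V_def clipped_solution_def)
    have dV: "(V has_vector_derivative A t *v V t + (g (t - \<theta>) (x t) 0 + q t)) (at t within {0..T})"
      if t: "t \<in> {0..T}" for t
    proof -
      from hyp(5) t have "(X has_vector_derivative f (clip (X t)) + \<epsilon> *\<^sub>R g (t - \<theta>) (clip (X t)) \<epsilon>)
          (at t within {0..T})" by (simp add: clipped_solution_def)
      then have "(X has_vector_derivative f (X t) + \<epsilon> *\<^sub>R g (t - \<theta>) (X t) \<epsilon>) (at t within {0..T})"
        by (simp add: clip_id[OF X\<rho>[OF t]])
      then have "(V has_vector_derivative (1 / \<epsilon>) *\<^sub>R (f (X t) + \<epsilon> *\<^sub>R g (t - \<theta>) (X t) \<epsilon> - f (x t)))
          (at t within {0..T})"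
        unfolding V_def[abs_def]
        by (intro bounded_linear.has_vector_derivative[OF bounded_linear_scaleR_right]
            has_vector_derivative_diff x_derivative)
      moreover have "(1 / \<epsilon>) *\<^sub>R (f (X t) + \<epsilon> *\<^sub>R g (t - \<theta>) (X t) \<epsilon> - f (x t))
          = A t *v V t + (g (t - \<theta>) (x t) 0 + q t)"
        using hyp(1) by (simp add: V_def q_def matrix_vector_mult_scaleR algebra_simps)
      ultimately show ?thesis by simp
    qed
    have "norm (V T - Y T *v v) \<le> \<kappa> * (norm (V 0 - Y 0 *v v) + (G + 1))"
      unfolding \<kappa>_def
    proof (rule gronwall_affine[where D' = "\<lambda>t. A t *v V t + (g (t - \<theta>) (x t) 0 + q t) - A t *v (Y t *v v)"])
      fix t assume t: "t \<in> {0..T}"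
      show "((\<lambda>t. V t - Y t *v v) has_vector_derivative
          A t *v V t + (g (t - \<theta>) (x t) 0 + q t) - A t *v (Y t *v v)) (at t within {0..T})"
        by (intro has_vector_derivative_diff dV[OF t] Y_derivative)
      have "norm (A t *v (V t - Y t *v v) + (g (t - \<theta>) (x t) 0 + q t))
          \<le> L * norm (V t - Y t *v v) + (G + 1)"
        using norm_A_mult[of t "V t - Y t *v v"] g_bound[OF norm_x[of t], of 0 "t - \<theta>"] q[OF t] \<mu>(2)
        by (intro order_trans[OF norm_triangle_ineq] add_mono) auto
      then show "norm (A t *v V t + (g (t - \<theta>) (x t) 0 + q t) - A t *v (Y t *v v))
          \<le> L * norm (V t - Y t *v v) + (G + 1)"
        by (simp add: matrix_vector_mult_diff_distrib algebra_simps)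
    qed (use L_nonneg G_nonneg T in auto)
    then have "norm (V T - Y T *v v) \<le> \<kappa> * (G + 1)" by (simp add: V0 Y0)
    then show "norm ((1 / \<epsilon>) *\<^sub>R (X T - x T) - Y T *v v) \<le> \<kappa> * (G + 1)"
      by (simp add: V_def)
    have "((\<lambda>t. z t \<bullet> (g (t - \<theta>) (x t) 0 + q t)) has_integral z T \<bullet> V T - z 0 \<bullet> V 0) {0..T}"
      using T adjoint_pairing[OF dV] by (intro fundamental_theorem_of_calculus) auto
    from has_integral_diff[OF this melnikov_has_integral[of \<theta>]]
    have "((\<lambda>t. z t \<bullet> q t) has_integral z T \<bullet> V T - z 0 \<bullet> V 0 - melnikov \<theta>) {0..T}"
      by (simp add: inner_add_right)
    moreover have "norm (z t \<bullet> q t) \<le> Z * \<mu>" if "t \<in> {0..T}" for t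
      using order_trans[OF Cauchy_Schwarz_ineq2 mult_mono[OF z_bound q[OF that] Z_nonneg norm_ge_zero]]
      by simp
    ultimately have "norm (z T \<bullet> V T - z 0 \<bullet> V 0 - melnikov \<theta>) \<le> Z * \<mu> * measure lborel {0..T}"
      using has_integral_bound[of "Z * \<mu>" "\<lambda>t. z t \<bullet> q t" "z T \<bullet> V T - z 0 \<bullet> V 0 - melnikov \<theta>" 0 T,
          unfolded cbox_interval] Z_nonneg \<mu>(1) by auto
    also have "\<dots> \<le> \<eta>" using \<mu>Z T by simp
    moreover have "z T = z 0" using z_per[unfolded periodic_def, rule_format, of 0] by simp
    ultimately have "\<bar>z 0 \<bullet> (V T - v) - melnikov \<theta>\<bar> \<le> \<eta>"
      by (simp only: V0 inner_diff_right real_norm_def)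
    then show "\<bar>z 0 \<bullet> ((1 / \<epsilon>) *\<^sub>R (X T - x T) - v) - melnikov \<theta>\<bar> \<le> \<eta>"
      by (simp only: V_def)
  qed
qed

section \<open>Existence of periodic solutions\<close>

text \<open>The map corrects the amplitude \<open>v\<close> by a Newton-type step, in which \<open>K\<close> is meant to invert the bordered
linearisation, and the phase \<open>\<theta>\<close> in proportion to the component of \<open>v\<close> along \<open>z 0\<close>. Both corrections are cut
off so that they stay in \<open>[a, b]\<close> times a ball.\<close>

lemma shooting_fixed_point:
  assumes ab: "a \<le> b" and R: "R \<ge> 0" and \<epsilon>: "0 < \<epsilon>" "\<epsilon> \<le> 1" and K: "linear K"
  obtains \<theta> v X where "\<theta> \<in> {a..b}" "norm v \<le> R" "clipped_solution \<theta> \<epsilon> v X"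
    "\<theta> = max a (min b (\<theta> - \<sigma> * (z 0 \<bullet> v)))"
    "v = closest_point (cball 0 R) (- K ((1 / \<epsilon>) *\<^sub>R (X T - x T) - Y T *v v))"
proof -
  define S where "S = {a..b} \<times> cball (0 :: real^'n) R"
  define F where "F t u s = f (clip u) + \<epsilon> *\<^sub>R g (t - fst s) (clip u) \<epsilon>" for t u and s :: "real \<times> (real^'n)"
  define \<Psi> where "\<Psi> s y = (max a (min b (fst s - \<sigma> * (z 0 \<bullet> snd s))),
      closest_point (cball 0 R) (- K ((1 / \<epsilon>) *\<^sub>R (y - x T) - Y T *v snd s)))"
    for s :: "real \<times> (real^'n)" and y
  obtain M where M: "\<And>v. v \<in> cball 0 \<rho> \<Longrightarrow> norm (f v) \<le> M"
  proof -
    have "bounded (f ` cball 0 \<rho>)"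
      by (intro compact_imp_bounded compact_continuous_image compact_cball
          continuous_on_subset[OF continuous_f]) auto
    then obtain M where "\<forall>v\<in>cball 0 \<rho>. norm (f v) \<le> M" by (auto simp: bounded_iff)
    then show thesis by (intro that[of M]) blast
  qed
  have cK: "continuous_on UNIV K" using K by (simp add: linear_continuous_on linear_conv_bounded_linear)
  have cP: "continuous_on UNIV (closest_point (cball (0 :: real^'n) R))"
    using R by (intro continuous_on_closest_point) auto
  obtain s X where s: "s \<in> S" "X 0 = x 0 + \<epsilon> *\<^sub>R snd s" "\<Psi> s (X T) = s"
    and X: "\<And>t. t \<in> {0..T} \<Longrightarrow> (X has_vector_derivative F t (X t) s) (at t within {0..T})"
  proof (rule boundary_value_problem_solvable[of T S F "M + \<epsilon> * G" "\<lambda>s. x 0 + \<epsilon> *\<^sub>R snd s" \<Psi>])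
    show "compact S" "convex S" "S \<noteq> {}"
      using ab R by (auto simp: S_def intro!: compact_Times convex_Times)
    show "continuous_on ({0..T} \<times> UNIV \<times> S) (\<lambda>(t, u, s). F t u s)"
    proof -
      have clip: "continuous_on ({0..T} \<times> UNIV \<times> S) (\<lambda>p. clip (fst (snd p)))"
        by (rule continuous_on_compose2[OF continuous_clip]) (auto intro!: continuous_intros)
      have "continuous_on ({0..T} \<times> UNIV \<times> S) (\<lambda>p. g (fst p - fst (snd (snd p))) (clip (fst (snd p))) \<epsilon>)"
        using \<epsilon> by (intro continuous_g clip) (auto intro!: continuous_intros)
      moreover have "continuous_on ({0..T} \<times> UNIV \<times> S) (\<lambda>p. f (clip (fst (snd p))))"
        by (rule continuous_on_compose2[OF continuous_f clip]) auto
      ultimately show ?thesis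
        unfolding F_def case_prod_beta by (intro continuous_on_add continuous_on_scaleR continuous_on_const)
    qed
    show "norm (F t u s) \<le> M + \<epsilon> * G" for t u s
      unfolding F_def using \<epsilon> M[of "clip u"] clip_in_cball g_bound
      by (intro order_trans[OF norm_triangle_ineq] add_mono) (auto intro: mult_left_mono)
    show "continuous_on (S \<times> UNIV) (\<lambda>(s, y). \<Psi> s y)"
    proof -
      have "continuous_on (S \<times> UNIV) (\<lambda>p. Y T *v snd (fst p))"
        by (intro bounded_linear.continuous_on[OF matrix_vector_mul_bounded_linear] continuous_intros)
      then have "continuous_on (S \<times> UNIV) (\<lambda>p. (1 / \<epsilon>) *\<^sub>R (snd p - x T) - Y T *v snd (fst p))"
        by (intro continuous_intros)
      then have "continuous_on (S \<times> UNIV) (\<lambda>p. K ((1 / \<epsilon>) *\<^sub>R (snd p - x T) - Y T *v snd (fst p)))"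
        by (rule continuous_on_compose2[OF cK]) auto
      then have "continuous_on (S \<times> UNIV)
          (\<lambda>p. closest_point (cball 0 R) (- K ((1 / \<epsilon>) *\<^sub>R (snd p - x T) - Y T *v snd (fst p))))"
        by (intro continuous_on_compose2[OF cP] continuous_on_minus) auto
      then show ?thesis
        unfolding \<Psi>_def case_prod_beta
        by (intro continuous_on_Pair continuous_on_max continuous_on_min continuous_intros)
    qed
    show "\<Psi> s y \<in> S" for s y
      using ab R closest_point_in_set[of "cball 0 R"] by (auto simp: \<Psi>_def S_def)
    show "continuous_on S (\<lambda>s. x 0 + \<epsilon> *\<^sub>R snd s)" by (intro continuous_intros)
  qed (use T that in auto)
  show thesis
  proof (rule that[of "fst s" "snd s" X])
    show "clipped_solution (fst s) \<epsilon> (snd s) X" using s X by (simp add: clipped_solution_def F_def)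
    show "fst s = max a (min b (fst s - \<sigma> * (z 0 \<bullet> snd s)))"
      using arg_cong[OF s(3), of fst] by (simp add: \<Psi>_def)
    show "snd s = closest_point (cball 0 R) (- K ((1 / \<epsilon>) *\<^sub>R (X T - x T) - Y T *v snd s))"
      using arg_cong[OF s(3), of snd] by (simp add: \<Psi>_def)
  qed (use s(1) in \<open>auto simp: S_def\<close>)
qed

text \<open>At a fixed point of the shooting map the cut-off of \<open>v\<close> is inactive, and the bordered inverse leaves the
defect \<open>V - v = - (z 0 \<bullet> v) f (x 0)\<close>. Pairing with \<open>z 0\<close> gives \<open>- (z 0 \<bullet> v) (z 0 \<bullet> f (x 0))\<close>, and by the
first-order expansion this is close to \<open>melnikov \<theta>\<close>. If it were not zero, the phase would have
been cut off at \<open>a\<close> or at \<open>b\<close>, but there the signs of \<open>melnikov\<close> make the correction point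
into the interval. So the defect vanishes.\<close>

lemma periodic_solutions_exist:
  assumes ab: "a \<le> b" and sign: "melnikov a * melnikov b < 0"
  obtains R \<epsilon>0 where "R \<ge> 0" "\<epsilon>0 > 0" "\<epsilon>0 \<le> 1"
    "\<And>\<epsilon>. 0 < \<epsilon> \<Longrightarrow> \<epsilon> < \<epsilon>0 \<Longrightarrow>
      \<exists>\<theta>\<in>{a..b}. \<exists>v X. norm v \<le> R \<and> clipped_solution \<theta> \<epsilon> v X \<and> X T = X 0"
proof -
  obtain K where K: "linear K" and bordered: "\<And>b. Y T *v K b - K b + (z 0 \<bullet> K b) *\<^sub>R f (x 0) = b"
    by (rule bordered_inverse[OF simple monodromy_velocity pairing_monodromy transversal])
      (rule that, assumption+)
  obtain B where B: "B > 0" "\<And>b. norm (K b) \<le> B * norm b"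
    using linear_bounded_pos[OF K] by blast
  define R where "R = B * (\<kappa> * (G + 1))"
  have R: "R \<ge> 0" using B \<kappa>_pos G_nonneg by (simp add: R_def)
  define \<eta> where "\<eta> = min \<bar>melnikov a\<bar> \<bar>melnikov b\<bar> / 2"
  have ne: "melnikov a \<noteq> 0" "melnikov b \<noteq> 0" using sign by auto
  then have \<eta>: "\<eta> > 0" "\<eta> < \<bar>melnikov a\<bar>" "\<eta> < \<bar>melnikov b\<bar>" by (auto simp: \<eta>_def min_def)
  obtain \<epsilon>0 where \<epsilon>0: "\<epsilon>0 > 0" "\<epsilon>0 \<le> 1"
    and endpoint: "\<And>\<epsilon> \<theta> v X. \<lbrakk>0 < \<epsilon>; \<epsilon> < \<epsilon>0; \<theta> \<in> {a..b}; norm v \<le> R; clipped_solution \<theta> \<epsilon> v X\<rbrakk>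
      \<Longrightarrow> norm ((1 / \<epsilon>) *\<^sub>R (X T - x T) - Y T *v v) \<le> \<kappa> * (G + 1)"
    and mel: "\<And>\<epsilon> \<theta> v X. \<lbrakk>0 < \<epsilon>; \<epsilon> < \<epsilon>0; \<theta> \<in> {a..b}; norm v \<le> R; clipped_solution \<theta> \<epsilon> v X\<rbrakk>
      \<Longrightarrow> \<bar>z 0 \<bullet> ((1 / \<epsilon>) *\<^sub>R (X T - x T) - v) - melnikov \<theta>\<bar> \<le> \<eta>"
    by (rule first_order_expansion[OF \<eta>(1) R, of a b]) (rule that, assumption+)
  show thesis
  proof (rule that[OF R \<epsilon>0])
    fix \<epsilon> assume \<epsilon>: "0 < \<epsilon>" "\<epsilon> < \<epsilon>0"
    have \<epsilon>1: "\<epsilon> \<le> 1" using \<epsilon> \<epsilon>0 by simp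
    \<comment> \<open>The gain is chosen so that \<open>\<sigma> (z 0 \<bullet> v) = - melnikov a * m\<close>, which points inward at both ends.\<close>
    define \<sigma> where "\<sigma> = melnikov a * (z 0 \<bullet> f (x 0))"
    obtain \<theta> v X where \<theta>: "\<theta> \<in> {a..b}" and v: "norm v \<le> R" and X: "clipped_solution \<theta> \<epsilon> v X"
      and fix_\<theta>: "\<theta> = max a (min b (\<theta> - \<sigma> * (z 0 \<bullet> v)))"
      and fix_v: "v = closest_point (cball 0 R) (- K ((1 / \<epsilon>) *\<^sub>R (X T - x T) - Y T *v v))"
      by (rule shooting_fixed_point[OF ab R \<epsilon>(1) \<epsilon>1 K])
    define V where "V = (1 / \<epsilon>) *\<^sub>R (X T - x T)"
    define c where "c = V - Y T *v v"
    have "norm (K c) \<le> B * norm c" by (rule B(2))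
    also have "\<dots> \<le> R"
      unfolding R_def c_def V_def using endpoint[OF \<epsilon> \<theta> v X] B(1) by (intro mult_left_mono) auto
    finally have "v = - K c"
      using fix_v by (simp add: closest_point_self c_def V_def)
    then have Kc: "K c = - v" by simp
    have defect: "V - v = - (z 0 \<bullet> v) *\<^sub>R f (x 0)"
    proof -
      have "Y T *v (- v) - (- v) + (z 0 \<bullet> (- v)) *\<^sub>R f (x 0) = c"
        using bordered[of c] by (simp only: Kc)
      then have "- (Y T *v v) + v - (z 0 \<bullet> v) *\<^sub>R f (x 0) = V - Y T *v v"
        by (simp add: c_def linear_neg[OF matrix_vector_mul_linear])
      then show ?thesis by (simp add: algebra_simps)
    qed
    define m where "m = z 0 \<bullet> (V - v)"
    have m: "\<bar>m - melnikov \<theta>\<bar> \<le> \<eta>" using mel[OF \<epsilon> \<theta> v X] by (simp add: m_def V_def)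
    have m_eq: "m = - (z 0 \<bullet> v) * (z 0 \<bullet> f (x 0))" unfolding m_def defect by simp
    have \<sigma>v: "\<sigma> * (z 0 \<bullet> v) = - melnikov a * m" by (simp add: \<sigma>_def m_eq)
    have "m = 0"
    proof (rule ccontr)
      assume "m \<noteq> 0"
      then have "\<sigma> * (z 0 \<bullet> v) \<noteq> 0" using ne by (simp add: \<sigma>v)
      moreover have "d \<noteq> 0 \<Longrightarrow> \<theta> = max a (min b (\<theta> - d)) \<Longrightarrow> \<theta> = a \<and> d > 0 \<or> \<theta> = b \<and> d < 0" for d
        using \<theta> unfolding atLeastAtMost_iff by linarith
      ultimately consider "\<theta> = a" "\<sigma> * (z 0 \<bullet> v) > 0" | "\<theta> = b" "\<sigma> * (z 0 \<bullet> v) < 0"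
        using fix_\<theta> by blast
      then show False
      proof cases
        case 1
        then have "melnikov a * m < 0" by (simp add: \<sigma>v)
        then show False using m \<eta>(2) 1 by (auto simp: mult_less_0_iff)
      next
        case 2
        then have "melnikov a * m > 0" by (simp add: \<sigma>v)
        then show False using m \<eta>(3) 2 sign by (auto simp: mult_less_0_iff zero_less_mult_iff)
      qed
    qed
    then have "z 0 \<bullet> v = 0" using transversal m_eq by simp
    then have "V = v" using defect by simp
    then have "\<epsilon> *\<^sub>R v = X T - x T" using \<epsilon>(1) by (auto simp: V_def)
    then have "X T = X 0" using X x_T by (simp add: clipped_solution_def)
    then show "\<exists>\<theta>\<in>{a..b}. \<exists>v X. norm v \<le> R \<and> clipped_solution \<theta> \<epsilon> v X \<and> X T = X 0"
      using \<theta> v X by blast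
  qed
qed

lemma periodic_solution_extends:
  assumes X: "clipped_solution \<theta> \<epsilon> v X" and XT: "X T = X 0" and \<epsilon>: "\<epsilon> \<in> {0..1}"
    and inside: "\<And>t. t \<in> {0..T} \<Longrightarrow> norm (X t) \<le> \<rho>"
  obtains U where "periodic T U" "solves_ode (\<lambda>t v. f v + \<epsilon> *\<^sub>R g t v \<epsilon>) U"
    "\<And>t. norm (U t - x (t + \<theta>)) \<le> \<epsilon> * (\<kappa> * (norm v + G))"
proof -
  have "periodic T (\<lambda>t. f v + \<epsilon> *\<^sub>R g (t - \<theta>) v \<epsilon>)" for v
    using g_per[OF \<epsilon>, of v] by (simp add: periodic_def add_diff_eq[symmetric] add.commute[of _ T])
  moreover have "(X has_vector_derivative f (X t) + \<epsilon> *\<^sub>R g (t - \<theta>) (X t) \<epsilon>) (at t within {0..T})"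
    if "t \<in> {0..T}" for t
  proof -
    from X that have "(X has_vector_derivative f (clip (X t)) + \<epsilon> *\<^sub>R g (t - \<theta>) (clip (X t)) \<epsilon>)
        (at t within {0..T})" by (simp add: clipped_solution_def)
    then show ?thesis by (simp add: clip_id[OF inside[OF that]])
  qed
  ultimately obtain W where W: "periodic T W" "solves_ode (\<lambda>t v. f v + \<epsilon> *\<^sub>R g (t - \<theta>) v \<epsilon>) W"
    and WX: "\<And>t. t \<in> {0..T} \<Longrightarrow> W t = X t"
    by (rule periodic_extension_solves_ode[OF T _ _ XT]) (assumption, rule that, assumption+)
  have dev: "norm (W t - x t) \<le> \<epsilon> * (\<kappa> * (norm v + G))" for t
  proof -
    obtain s where s: "s \<in> {0..T}" "\<And>y :: real \<Rightarrow> real^'n. periodic T y \<Longrightarrow> y t = y s"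
      by (rule periodic_eq_on_period[OF T W(1), of t]) (rule that, assumption+)
    show ?thesis
      using clipped_solution_deviation[OF X \<epsilon> s(1)] s(2)[OF W(1)] s(2)[OF x_per] WX[OF s(1)] by simp
  qed
  show thesis
  proof (rule that[of "\<lambda>t. W (t + \<theta>)"])
    show "periodic T (\<lambda>t. W (t + \<theta>))"
      using W(1) by (simp add: periodic_def) (metis add.assoc add.commute)
    show "solves_ode (\<lambda>t v. f v + \<epsilon> *\<^sub>R g t v \<epsilon>) (\<lambda>t. W (t + \<theta>))"
      unfolding solves_ode_def
    proof
      fix t
      have "(W has_vector_derivative f (W (t + \<theta>)) + \<epsilon> *\<^sub>R g t (W (t + \<theta>)) \<epsilon>) (at (t + \<theta>))"
        using W(2)[unfolded solves_ode_def, rule_format, of "t + \<theta>"] by simp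
      moreover have "((\<lambda>t. t + \<theta>) has_vector_derivative 1) (at t)"
        by (auto intro!: derivative_eq_intros)
      ultimately show "((\<lambda>t. W (t + \<theta>)) has_vector_derivative
          f (W (t + \<theta>)) + \<epsilon> *\<^sub>R g t (W (t + \<theta>)) \<epsilon>) (at t)"
        using vector_diff_chain_at[of "\<lambda>t. t + \<theta>" 1 t W] by (simp add: o_def)
    qed
    show "norm (W (t + \<theta>) - x (t + \<theta>)) \<le> \<epsilon> * (\<kappa> * (norm v + G))" for t by (rule dev)
  qed
qed

end

section \<open>Convergence to the zeros of the bifurcation function\<close>

text \<open>The zeros may form an arbitrary compact set, so there is no lower bound near a single zero;
outside a neighbourhood of all of them, compactness gives one.\<close>

lemma small_values_near_zeros:
  fixes m :: "real \<Rightarrow> real"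
  assumes m: "continuous_on {a..b} m" and ends: "m a \<noteq> 0" "m b \<noteq> 0"
    and \<delta>: "\<delta> > 0"
  obtains \<eta> where "\<eta> > 0"
    "\<And>\<theta>. \<theta> \<in> {a..b} \<Longrightarrow> \<bar>m \<theta>\<bar> \<le> \<eta> \<Longrightarrow> \<exists>\<theta>'. a < \<theta>' \<and> \<theta>' < b \<and> m \<theta>' = 0 \<and> \<bar>\<theta> - \<theta>'\<bar> < \<delta>"
proof -
  define N where "N = {\<theta>. a < \<theta> \<and> \<theta> < b \<and> m \<theta> = 0}"
  define K where "K = {a..b} - (\<Union>\<theta>'\<in>N. ball \<theta>' \<delta>)"
  have N: "\<exists>\<theta>'. a < \<theta>' \<and> \<theta>' < b \<and> m \<theta>' = 0 \<and> \<bar>\<theta> - \<theta>'\<bar> < \<delta>" if "\<theta> \<in> {a..b}" "\<theta> \<notin> K" for \<theta>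
    using that by (auto simp: K_def N_def dist_real_def abs_minus_commute)
  show thesis
  proof (cases "K = {}")
    case True
    then show thesis using N that[of 1] by auto
  next
    case False
    have "compact K" unfolding K_def by (intro compact_diff) auto
    moreover have "continuous_on K (\<lambda>\<theta>. \<bar>m \<theta>\<bar>)"
      by (intro continuous_on_rabs continuous_on_subset[OF m]) (auto simp: K_def)
    ultimately obtain k where k: "k \<in> K" "\<And>\<theta>. \<theta> \<in> K \<Longrightarrow> \<bar>m k\<bar> \<le> \<bar>m \<theta>\<bar>"
      using continuous_attains_inf[of K "\<lambda>\<theta>. \<bar>m \<theta>\<bar>"] False by blast
    have "m k \<noteq> 0"
    proof
      assume "m k = 0"
      then have "k \<in> N" using k(1) ends by (auto simp: N_def K_def less_le)
      then show False using k(1) \<delta> by (auto simp: K_def)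
    qed
    then show thesis
      using N k(2) by (intro that[of "\<bar>m k\<bar> / 2"]) fastforce+
  qed
qed

lemma periodic_continuous_bounded:
  fixes x :: "real \<Rightarrow> 'a::real_normed_vector"
  assumes "T > 0" "periodic T x" "continuous_on {0..T} x"
  obtains M where "\<And>t. norm (x t) \<le> M"
proof -
  have "bounded (x ` {0..T})" using assms(3) by (intro compact_imp_bounded compact_continuous_image) auto
  then obtain M where M: "\<forall>t\<in>{0..T}. norm (x t) \<le> M" by (auto simp: bounded_iff)
  have "norm (x t) \<le> M" for t
  proof (rule periodic_eq_on_period[OF assms(1,2), of t])
    fix s assume s: "s \<in> {0..T}" "\<And>y :: real \<Rightarrow> 'a. periodic T y \<Longrightarrow> y t = y s"
    show ?thesis using M s(1) s(2)[OF assms(2)] by simp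
  qed
  then show thesis by (rule that)
qed

context perturbed_cycle
begin

lemma cycle_lipschitz:
  obtains N where "N \<ge> 0" "\<And>s t. norm (x s - x t) \<le> N * \<bar>s - t\<bar>"
proof -
  have "periodic T (\<lambda>t. f (x t))" using x_per by (simp add: periodic_def)
  moreover have "continuous_on {0..T} (\<lambda>t. f (x t))"
    by (rule continuous_on_compose2[OF continuous_f continuous_x]) auto
  ultimately obtain N where N: "\<And>t. norm (f (x t)) \<le> N"
    using periodic_continuous_bounded[OF T] by blast
  have "norm (x s - x t) \<le> N * norm (s - t)" for s t
  proof (rule differentiable_bound[of UNIV])
    show "(x has_derivative (\<lambda>h. h *\<^sub>R f (x t))) (at t within UNIV)" for t
      using x_derivative[of t UNIV] by (simp add: has_vector_derivative_def)
    show "onorm (\<lambda>h. h *\<^sub>R f (x t)) \<le> N" for t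
      by (rule onorm_le) (simp add: N mult.commute[of N] mult_left_mono)
  qed auto
  moreover have "N \<ge> 0" using order_trans[OF norm_ge_zero N[of 0]] .
  ultimately show thesis using that by simp
qed

text \<open>The radius \<open>R\<close> is fixed once, and the estimate of \<open>melnikov \<theta>\<close> holds for every periodic
solution with \<open>\<bar>v\<bar> \<le> R\<close>. Therefore an arbitrary choice of one solution for each \<open>\<epsilon>\<close> converges.\<close>

theorem periodic_solutions_near_cycle:
  assumes ab: "a \<le> b" and sign: "melnikov a * melnikov b < 0"
  defines "\<Theta> \<equiv> {\<theta>. a < \<theta> \<and> \<theta> < b \<and> melnikov \<theta> = 0}"
  obtains X where
    "\<forall>\<^sub>F \<epsilon> in at_right 0. solves_ode (\<lambda>t v. f v + \<epsilon> *\<^sub>R g t v \<epsilon>) (X \<epsilon>) \<and> periodic T (X \<epsilon>)"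
    "uniform_limit UNIV (\<lambda>\<epsilon> t. infdist (X \<epsilon> t) ((\<lambda>\<theta>. x (t + \<theta>)) ` \<Theta>)) (\<lambda>t. 0) (at_right 0)"
proof -
  obtain R \<epsilon>1 where R: "R \<ge> 0" and \<epsilon>1: "\<epsilon>1 > 0" "\<epsilon>1 \<le> 1"
    and ex: "\<And>\<epsilon>. 0 < \<epsilon> \<Longrightarrow> \<epsilon> < \<epsilon>1 \<Longrightarrow>
      \<exists>\<theta>\<in>{a..b}. \<exists>v X. norm v \<le> R \<and> clipped_solution \<theta> \<epsilon> v X \<and> X T = X 0"
    by (rule periodic_solutions_exist[OF ab sign]) (rule that, assumption+)
  obtain \<epsilon>2 where \<epsilon>2: "\<epsilon>2 > 0" "\<epsilon>2 \<le> 1"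
    and inside: "\<And>\<epsilon> \<theta> v X t. \<lbrakk>0 < \<epsilon>; \<epsilon> < \<epsilon>2; \<theta> \<in> {a..b}; norm v \<le> R; clipped_solution \<theta> \<epsilon> v X; t \<in> {0..T}\<rbrakk>
      \<Longrightarrow> norm (X t) \<le> \<rho>"
    by (rule first_order_expansion[OF zero_less_one R, of a b]) (rule that, assumption+)
  define C where "C = \<kappa> * (R + G)"
  have C: "C \<ge> 0" using \<kappa>_pos R G_nonneg by (simp add: C_def)
  define P where "P \<epsilon> U \<longleftrightarrow> solves_ode (\<lambda>t v. f v + \<epsilon> *\<^sub>R g t v \<epsilon>) U \<and> periodic T U \<and>
      (\<exists>\<theta>\<in>{a..b}. (\<exists>v X. norm v \<le> R \<and> clipped_solution \<theta> \<epsilon> v X \<and> X T = X 0) \<and>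
        (\<forall>t. norm (U t - x (t + \<theta>)) \<le> \<epsilon> * C))" for \<epsilon> U
  define X where "X \<epsilon> = (SOME U. P \<epsilon> U)" for \<epsilon>
  have PX: "P \<epsilon> (X \<epsilon>)" if \<epsilon>: "0 < \<epsilon>" "\<epsilon> < \<epsilon>1" "\<epsilon> < \<epsilon>2" for \<epsilon>
  proof -
    obtain \<theta> v X0 where \<theta>: "\<theta> \<in> {a..b}" and v: "norm v \<le> R"
      and X0: "clipped_solution \<theta> \<epsilon> v X0" "X0 T = X0 0"
      using ex[OF \<epsilon>(1,2)] by blast
    have \<epsilon>01: "\<epsilon> \<in> {0..1}" using \<epsilon> \<epsilon>1 by simp
    obtain U where U: "periodic T U" "solves_ode (\<lambda>t v. f v + \<epsilon> *\<^sub>R g t v \<epsilon>) U"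
      and dev: "\<And>t. norm (U t - x (t + \<theta>)) \<le> \<epsilon> * (\<kappa> * (norm v + G))"
      by (rule periodic_solution_extends[OF X0 \<epsilon>01 inside[OF \<epsilon>(1,3) \<theta> v X0(1)]])
        (assumption, rule that, assumption+)
    have "\<epsilon> * (\<kappa> * (norm v + G)) \<le> \<epsilon> * C"
      unfolding C_def using \<epsilon>(1) \<kappa>_pos v by (intro mult_left_mono) auto
    then have "\<forall>t. norm (U t - x (t + \<theta>)) \<le> \<epsilon> * C" using dev order_trans by blast
    then have "P \<epsilon> U" using U \<theta> v X0 unfolding P_def by blast
    then show ?thesis unfolding X_def by (rule someI[of "P \<epsilon>"])
  qed
  obtain N where N: "N \<ge> 0" "\<And>s t. norm (x s - x t) \<le> N * \<bar>s - t\<bar>"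
    by (rule cycle_lipschitz) (rule that, assumption+)
  show thesis
  proof (rule that)
    have "\<forall>\<^sub>F \<epsilon> in at_right 0. 0 < \<epsilon> \<and> \<epsilon> < \<epsilon>1 \<and> \<epsilon> < \<epsilon>2"
      using \<epsilon>1 \<epsilon>2 by (auto simp: eventually_at_right_field intro!: exI[of _ "min \<epsilon>1 \<epsilon>2"])
    then show "\<forall>\<^sub>F \<epsilon> in at_right 0. solves_ode (\<lambda>t v. f v + \<epsilon> *\<^sub>R g t v \<epsilon>) (X \<epsilon>) \<and> periodic T (X \<epsilon>)"
      by eventually_elim (use PX P_def in blast)
    show "uniform_limit UNIV (\<lambda>\<epsilon> t. infdist (X \<epsilon> t) ((\<lambda>\<theta>. x (t + \<theta>)) ` \<Theta>)) (\<lambda>t. 0) (at_right 0)"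
    proof (rule uniform_limitI)
      fix e :: real assume e: "e > 0"
      define \<delta> where "\<delta> = e / (2 * (N + 1))"
      have \<delta>: "\<delta> > 0" "N * \<delta> \<le> e / 2" using e N(1) by (auto simp: \<delta>_def field_simps)
      have ends: "melnikov a \<noteq> 0" "melnikov b \<noteq> 0" using sign by auto
      obtain \<eta> where \<eta>: "\<eta> > 0" and near: "\<And>\<theta>. \<theta> \<in> {a..b} \<Longrightarrow> \<bar>melnikov \<theta>\<bar> \<le> \<eta> \<Longrightarrow>
          \<exists>\<theta>'. a < \<theta>' \<and> \<theta>' < b \<and> melnikov \<theta>' = 0 \<and> \<bar>\<theta> - \<theta>'\<bar> < \<delta>"
        by (rule small_values_near_zeros[OF continuous_melnikov ends \<delta>(1)]) (rule that, assumption+)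
      obtain \<epsilon>3 where \<epsilon>3: "\<epsilon>3 > 0"
        and mel: "\<And>\<epsilon> \<theta> v X. \<lbrakk>0 < \<epsilon>; \<epsilon> < \<epsilon>3; \<theta> \<in> {a..b}; norm v \<le> R; clipped_solution \<theta> \<epsilon> v X\<rbrakk>
          \<Longrightarrow> \<bar>z 0 \<bullet> ((1 / \<epsilon>) *\<^sub>R (X T - x T) - v) - melnikov \<theta>\<bar> \<le> \<eta>"
        by (rule first_order_expansion[OF \<eta> R, of a b]) (rule that, assumption+)
      define \<epsilon>4 where "\<epsilon>4 = e / (2 * (C + 1))"
      have \<epsilon>4: "\<epsilon>4 > 0" using e C by (simp add: \<epsilon>4_def)
      have "\<forall>\<^sub>F \<epsilon> in at_right 0. 0 < \<epsilon> \<and> \<epsilon> < \<epsilon>1 \<and> \<epsilon> < \<epsilon>2 \<and> \<epsilon> < \<epsilon>3 \<and> \<epsilon> < \<epsilon>4"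
        using \<epsilon>1 \<epsilon>2 \<epsilon>3 \<epsilon>4
        by (auto simp: eventually_at_right_field intro!: exI[of _ "min (min \<epsilon>1 \<epsilon>2) (min \<epsilon>3 \<epsilon>4)"])
      then show "\<forall>\<^sub>F \<epsilon> in at_right 0. \<forall>t\<in>UNIV. dist (infdist (X \<epsilon> t) ((\<lambda>\<theta>. x (t + \<theta>)) ` \<Theta>)) 0 < e"
      proof eventually_elim
        case (elim \<epsilon>)
        then have "P \<epsilon> (X \<epsilon>)" using PX by blast
        then obtain \<theta> v X0 where \<theta>: "\<theta> \<in> {a..b}" and v: "norm v \<le> R"
          and X0: "clipped_solution \<theta> \<epsilon> v X0" "X0 T = X0 0"
          and dev: "\<And>t. norm (X \<epsilon> t - x (t + \<theta>)) \<le> \<epsilon> * C"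
          unfolding P_def by blast
        have "(1 / \<epsilon>) *\<^sub>R (X0 T - x T) = v"
          using X0 elim by (simp add: clipped_solution_def x_T)
        then have "\<bar>melnikov \<theta>\<bar> \<le> \<eta>" using mel[OF _ _ \<theta> v X0(1)] elim by simp
        then obtain \<theta>' where \<theta>': "\<theta>' \<in> \<Theta>" "\<bar>\<theta> - \<theta>'\<bar> < \<delta>"
          using near[OF \<theta>] by (auto simp: \<Theta>_def)
        have "\<epsilon> * (C + 1) < e / 2" using elim C by (simp add: \<epsilon>4_def field_simps)
        then have small: "\<epsilon> * C < e / 2" using elim by (simp add: algebra_simps)
        show ?case
        proof
          fix t
          have "infdist (X \<epsilon> t) ((\<lambda>\<theta>. x (t + \<theta>)) ` \<Theta>) \<le> dist (X \<epsilon> t) (x (t + \<theta>'))"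
            using \<theta>'(1) by (intro infdist_le) auto
          also have "\<dots> \<le> norm (X \<epsilon> t - x (t + \<theta>)) + norm (x (t + \<theta>) - x (t + \<theta>'))"
            by (metis dist_norm dist_triangle)
          also have "\<dots> \<le> \<epsilon> * C + N * \<delta>"
            using dev[of t] N(2)[of "t + \<theta>" "t + \<theta>'"] mult_left_mono[OF less_imp_le[OF \<theta>'(2)] N(1)]
            by simp
          also have "\<dots> < e" using small \<delta>(2) by simp
          finally show "dist (infdist (X \<epsilon> t) ((\<lambda>\<theta>. x (t + \<theta>)) ` \<Theta>)) 0 < e"
            by (simp add: infdist_nonneg)
        qed
      qed
    qed
  qed
qed

end

theorem mainTheorem3:
  fixes f :: "real^'n \<Rightarrow> real^'n"
    and g :: "real \<Rightarrow> real^'n \<Rightarrow> real \<Rightarrow> real^'n"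
    and x z :: "real \<Rightarrow> real^'n"
    and T \<theta>1 \<theta>2 :: real and p :: nat
  defines "M \<equiv> bifurcation_fun T g x z"
  defines "\<Theta> \<equiv> {\<theta>. \<theta>1 < \<theta> \<and> \<theta> < \<theta>2 \<and> M \<theta> = 0}"
  assumes "T > 0"
    and "C1 f"
    and "continuous_on (UNIV \<times> UNIV \<times> {0..1}) (\<lambda>(t, v, \<epsilon>). g t v \<epsilon>)"
    and "\<And>v \<epsilon>. \<epsilon> \<in> {0..1} \<Longrightarrow> periodic T (\<lambda>t. g t v \<epsilon>)"
    and "simple_cycle T f x"
    and "adjoint_solution T f x z"
    and "least_period (T / real p) x"
    and "0 \<le> \<theta>1" and "\<theta>1 < \<theta>2" and "\<theta>2 \<le> \<theta>1 + T / real p"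
    and "M \<theta>1 * M \<theta>2 < 0"
  shows "\<exists>X :: real \<Rightarrow> real \<Rightarrow> real^'n.
     (\<forall>\<^sub>F \<epsilon> in at_right 0.
        solves_ode (\<lambda>t v. f v + \<epsilon> *\<^sub>R g t v \<epsilon>) (X \<epsilon>) \<and> periodic T (X \<epsilon>)) \<and>
     uniform_limit UNIV (\<lambda>\<epsilon> t. infdist (X \<epsilon> t) ((\<lambda>\<theta>. x (t + \<theta>)) ` \<Theta>)) (\<lambda>t. 0) (at_right 0)"
proof -
  note T = \<open>T > 0\<close> and f = \<open>C1 f\<close>
  have x: "solves_ode (\<lambda>t. f) x" "periodic T x"
    using \<open>simple_cycle T f x\<close> by (auto simp: simple_cycle_def periodic_cycle_def)
  obtain Y where Y: "solves_ode (\<lambda>t Z. jacobian f (at (x t)) ** Z) Y" "Y 0 = mat 1"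
    and simple: "order 1 (char_polynomial (Y T)) = 1"
    using \<open>simple_cycle T f x\<close> by (auto simp: simple_cycle_def is_monodromy_matrix_def)
  have z: "solves_ode (\<lambda>t v. - (transpose (jacobian f (at (x t))) *v v)) z" "periodic T z"
    using \<open>adjoint_solution T f x z\<close> by (auto simp: adjoint_solution_def)
  have "vector_derivative x (at 0) = f (x 0)"
    using x(1) by (auto simp: solves_ode_def intro: vector_derivative_at)
  then have M: "M \<theta> = sgn (f (x 0) \<bullet> z 0) * integral {0..T} (\<lambda>\<tau>. z \<tau> \<bullet> g (\<tau> - \<theta>) (x \<tau>) 0)" for \<theta>
    by (simp add: M_def bifurcation_fun_def)
  \<comment> \<open>A vanishing sign would make the bifurcation function identically zero.\<close>
  have nonzero: "f (x 0) \<bullet> z 0 \<noteq> 0" using \<open>M \<theta>1 * M \<theta>2 < 0\<close> by (auto simp: M)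
  have cont: "continuous_on {0..T} y" if "solves_ode F y" for F and y :: "real \<Rightarrow> real^'n"
    by (rule continuous_on_vector_derivative[OF
        has_vector_derivative_at_within[OF that[unfolded solves_ode_def, rule_format]]])
  obtain \<rho>0 where \<rho>0: "\<And>t. norm (x t) \<le> \<rho>0"
    by (rule periodic_continuous_bounded[OF T x(2) cont[OF x(1)]]) (rule that, assumption)
  obtain Z where Z: "\<And>t. norm (z t) \<le> Z"
    by (rule periodic_continuous_bounded[OF T z(2) cont[OF z(1)]]) (rule that, assumption)
  define \<rho> where "\<rho> = \<rho>0 + 1"
  have "bounded ((\<lambda>v. jacobian f (at v)) ` cball 0 \<rho>)"
    using f by (intro compact_imp_bounded compact_continuous_image)
      (auto simp: C1_def intro: continuous_on_subset)
  then obtain L where "\<forall>v\<in>cball 0 \<rho>. norm (jacobian f (at v)) \<le> L"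
    by (auto simp: bounded_iff)
  then have L: "\<And>v. norm v \<le> \<rho> \<Longrightarrow> norm (jacobian f (at v)) \<le> L" by simp
  have "bounded ((\<lambda>(t, v, \<epsilon>). g t v \<epsilon>) ` ({0..T} \<times> cball 0 \<rho> \<times> {0..1}))"
    by (intro compact_imp_bounded compact_continuous_image compact_Times compact_Icc compact_cball
        continuous_on_subset[OF assms(5)]) auto
  then obtain G where G: "\<forall>q \<in> {0..T} \<times> cball 0 \<rho> \<times> {0..1}. norm ((\<lambda>(t, v, \<epsilon>). g t v \<epsilon>) q) \<le> G"
    by (auto simp: bounded_iff)
  have g_bound: "norm (g t v \<epsilon>) \<le> G" if "norm v \<le> \<rho>" "\<epsilon> \<in> {0..1}" for t v \<epsilon>
  proof (rule periodic_eq_on_period[OF T assms(6)[OF that(2), of v], of t])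
    fix s assume s: "s \<in> {0..T}" "\<And>y :: real \<Rightarrow> real^'n. periodic T y \<Longrightarrow> y t = y s"
    then have "g t v \<epsilon> = g s v \<epsilon>" using assms(6)[OF that(2), of v] by blast
    then show ?thesis using G s(1) that by auto
  qed
  interpret perturbed_cycle f g x z Y T \<rho> L G Z
    using T f assms(5,6) x Y simple z nonzero \<rho>0 L g_bound Z
    by unfold_locales (auto simp: \<rho>_def inner_commute)
  have M_eq: "M \<theta> = sgn (f (x 0) \<bullet> z 0) * melnikov \<theta>" for \<theta> by (simp add: M melnikov_def)
  have \<Theta>: "\<Theta> = {\<theta>. \<theta>1 < \<theta> \<and> \<theta> < \<theta>2 \<and> melnikov \<theta> = 0}"
    using nonzero by (simp add: \<Theta>_def M_eq sgn_eq_0_iff)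
  have "M \<theta>1 * M \<theta>2 = melnikov \<theta>1 * melnikov \<theta>2"
    using nonzero by (simp add: M_eq sgn_if)
  then have sign: "melnikov \<theta>1 * melnikov \<theta>2 < 0" using \<open>M \<theta>1 * M \<theta>2 < 0\<close> by simp
  show ?thesis
    unfolding \<Theta> using \<open>\<theta>1 < \<theta>2\<close> by (rule periodic_solutions_near_cycle[OF less_imp_le sign]) blast
qed

end
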